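(* Let $D$ be a domain in $\mathbb{R}^d$. Assume there exist points $p\in\partial D$, $q\in D$ and a sequence $(\varphi_j)$ of projective automorphisms of $D$ such that $\varphi_j(q)\to p$. If $p$ is a strictly convex boundary point of $D$, then $D$ is projectively equivalent to the unit ball.
   Context: $\mathbb{R}^d$ is embedded in $\mathbb{P}\mathbb{R}^d$ as the points $(1:x_1:\dots:x_d)$; a projective map is a map induced by a linear map of $\mathbb{R}^{d+1}$ acting on homogeneous coordinates (a linear-fractional map on $\mathbb{R}^d$). A projective automorphism of $D$ is a bijective projective map of $D$ onto itself; $D$ is projectively equivalent to the unit ball if some projective map sends $D$ bijectively onto the open unit ball. A point $p\in\partial D$ is strictly convex if $\partial D$ is $\mathcal{C}^2$-smooth in a neighborhood of $p$ and the restriction to the tangent hyperplane at $p$ of the Hessian of a (local) defining function is positive definite. *)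

theory Defs
  imports "HOL-Analysis.Analysis"
begin

text \<open>R^d is modelled as real^'n for a finite index type 'n (d = CARD('n)).
A linear map of R^(d+1) acting on homogeneous coordinates (t : x) is written in block form
  (t, x) |-> (c*t + w.x, t*b + A x).
On the affine chart t = 1 it induces the linear-fractional map below, defined where the
first homogeneous coordinate c + w.x does not vanish.\<close>

definition proj_fun :: "real \<Rightarrow> real^'n \<Rightarrow> real^'n \<Rightarrow> real^'n^'n \<Rightarrow> real^'n \<Rightarrow> real^'n" where
  "proj_fun c w b A x = (1 / (c + w \<bullet> x)) *\<^sub>R (b + A *v x)"

definition projective_map_on :: "(real^'n) set \<Rightarrow> (real^'n \<Rightarrow> real^'n) \<Rightarrow> bool" where
  "projective_map_on D f \<longleftrightarrow>
     (\<exists>c w b A. \<forall>x\<in>D. c + w \<bullet> x \<noteq> 0 \<and> f x = proj_fun c w b A x)"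

definition projective_automorphism :: "(real^'n) set \<Rightarrow> (real^'n \<Rightarrow> real^'n) \<Rightarrow> bool" where
  "projective_automorphism D f \<longleftrightarrow> projective_map_on D f \<and> bij_betw f D D"

definition projectively_equivalent_to_ball :: "(real^'n) set \<Rightarrow> bool" where
  "projectively_equivalent_to_ball D \<longleftrightarrow>
     (\<exists>f. projective_map_on D f \<and> bij_betw f D (ball 0 1))"

definition domain :: "(real^'n) set \<Rightarrow> bool" where
  "domain D \<longleftrightarrow> open D \<and> connected D \<and> D \<noteq> {}"

definition strictly_convex_boundary_point :: "(real^'n) set \<Rightarrow> real^'n \<Rightarrow> bool" where
  "strictly_convex_boundary_point D p \<longleftrightarrow> p \<in> frontier D \<and>
     (\<exists>U \<rho> g H. open U \<and> p \<in> U \<and>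
        (\<forall>x\<in>U. (\<rho> has_derivative (\<lambda>h. g x \<bullet> h)) (at x)) \<and>
        (\<forall>x\<in>U. (g has_derivative (\<lambda>h. H x *v h)) (at x)) \<and>
        continuous_on U H \<and>
        D \<inter> U = {x\<in>U. \<rho> x < 0} \<and>
        g p \<noteq> 0 \<and>
        (\<forall>v. v \<noteq> 0 \<and> g p \<bullet> v = 0 \<longrightarrow> v \<bullet> (H p *v v) > 0))"

end

theory Submission
  imports Defs
begin

text \<open>Replace the defining function \<open>\<rho>\<close> near \<open>p\<close> by \<open>\<sigma> = \<rho> + K \<rho>\<^sup>2\<close>, whose Hessian
  at \<open>p\<close> is positive definite. Automorphisms preserve segments and
  cross-ratios, and a segment of \<open>D\<close> near \<open>p\<close> is short on at least one side; hence the whole orbit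
  \<open>\<phi>\<^sub>j\<close> tends to \<open>p\<close> pointwise, and pulling back segments from the convex piece of
  \<open>D\<close> near \<open>p\<close> shows that \<open>D\<close> is convex.

  By convexity, at a boundary point near \<open>p\<close> the domain \<open>D\<close> lies inside a global quadric
  (a Lorentz cone in homogeneous coordinates) which differs by \<open>\<epsilon>\<close> from a quadric locally
  contained in \<open>D\<close>. Pull the outer cone back by \<open>\<phi>\<^sub>j\<close> and scale its quadratic form to
  be 1 at \<open>q\<close>. These forms are positive on a fixed ball, so they stay bounded and subconverge.
  Points inside the limit cone are mapped by \<open>\<phi>\<^sub>j\<close> to within bounded Lorentz distance of
  \<open>\<phi>\<^sub>j q\<close>, where the inner and outer quadrics are indistinguishable, so the limit cone is
  exactly the cone over \<open>D\<close>. A degenerate limit form would give a line in \<open>D\<close>, which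
  strict convexity at \<open>p\<close> excludes; so \<open>D\<close> is projectively a ball.\<close>

section \<open>Positive definite forms and linear lifts of projective maps\<close>

text \<open>Gram-Schmidt with respect to \<open>G\<close>, applied to the standard basis, yields a
  \<open>G\<close>-orthonormal basis \<open>e\<close>. The rows of \<open>A\<close> are the vectors
  \<open>G *v e i\<close>, so \<open>A *v v\<close> lists the coordinates of \<open>v\<close> in
  that basis, and the claim is Parseval's identity.\<close>

lemma posdef_form_eq_norm_square:
  fixes G :: "real^'n^'n"
  assumes sym: "\<And>v w. v \<bullet> (G *v w) = w \<bullet> (G *v v)"
    and pos: "\<And>v. v \<noteq> 0 \<Longrightarrow> v \<bullet> (G *v v) > 0"
  obtains A :: "real^'n^'n" where "\<And>v. (norm (A *v v))\<^sup>2 = v \<bullet> (G *v v)"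
proof -
  let ?a = "\<lambda>i::'n. axis i (1::real)"
  \<comment> \<open>The inclusion of the \<open>e i\<close> in the span of the axes makes each
    Gram-Schmidt remainder nonzero; the reverse inclusion makes \<open>e\<close> a spanning family
    at the end.\<close>
  have "\<exists>e::'n \<Rightarrow> real^'n. (\<forall>i\<in>I. \<forall>j\<in>I. e i \<bullet> (G *v e j) = (if i = j then 1 else 0)) \<and>
      e ` I \<subseteq> span (?a ` I) \<and> ?a ` I \<subseteq> span (e ` I)" if "finite I" for I
    using that
  proof induction
    case empty
    show ?case by simp
  next
    case (insert k I)
    then obtain e where orth: "\<forall>i\<in>I. \<forall>j\<in>I. e i \<bullet> (G *v e j) = (if i = j then 1 else 0)"
      and e1: "e ` I \<subseteq> span (?a ` I)" and e2: "?a ` I \<subseteq> span (e ` I)"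
      by blast
    define s where "s = (\<Sum>i\<in>I. (e i \<bullet> (G *v ?a k)) *\<^sub>R e i)"
    define x where "x = ?a k - s"
    have s_e: "s \<in> span (e ` I)"
      unfolding s_def by (intro span_sum span_scale span_base) auto
    have s_a: "s \<in> span (?a ` I)"
      unfolding s_def using e1 by (intro span_sum span_scale) auto
    have "?a k \<notin> span (?a ` I)"
    proof
      assume "?a k \<in> span (?a ` I)"
      then have "?a k $ k = 0"
      proof (induction rule: span_induct)
        case base
        show ?case by (auto simp: subspace_def)
      next
        case (step x)
        then show ?case using insert.hyps by (auto simp: axis_def)
      qed
      then show False by simp
    qed
    then have "x \<noteq> 0"
      using s_a by (auto simp: x_def)
    then have xpos: "x \<bullet> (G *v x) > 0" by (rule pos)
    have xorth: "e i \<bullet> (G *v x) = 0" if "i \<in> I" for i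
    proof -
      have "e i \<bullet> (G *v s) = (\<Sum>j\<in>I. (e j \<bullet> (G *v ?a k)) * (e i \<bullet> (G *v e j)))"
        by (simp add: s_def linear_sum[OF matrix_vector_mul_linear] inner_sum_right
            matrix_vector_mult_scaleR)
      also have "\<dots> = (\<Sum>j\<in>I. if j = i then e j \<bullet> (G *v ?a k) else 0)"
        using orth that by (intro sum.cong) auto
      also have "\<dots> = e i \<bullet> (G *v ?a k)"
        using that insert.hyps by simp
      finally show ?thesis
        by (simp add: x_def matrix_vector_mult_diff_distrib inner_diff_right)
    qed
    define r where "r = sqrt (x \<bullet> (G *v x))"
    have r: "r > 0" "r * r = x \<bullet> (G *v x)"
      using xpos by (auto simp: r_def)
    define e' where "e' = e(k := (1/r) *\<^sub>R x)"
    have e'_I: "e' i = e i" if "i \<in> I" for i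
      using that insert.hyps by (auto simp: e'_def)
    have im: "e' ` I = e ` I"
      using e'_I by force
    have x_span: "x \<in> span (e' ` insert k I)"
    proof -
      have "r *\<^sub>R e' k \<in> span (e' ` insert k I)"
        by (intro span_scale span_base) auto
      then show ?thesis using r by (simp add: e'_def)
    qed
    have "\<forall>i\<in>insert k I. \<forall>j\<in>insert k I. e' i \<bullet> (G *v e' j) = (if i = j then 1 else 0)"
    proof (intro ballI)
      fix i j assume "i \<in> insert k I" "j \<in> insert k I"
      then consider "i \<in> I" "j \<in> I" | "i = k" "j \<in> I" | "i \<in> I" "j = k" | "i = k" "j = k"
        by auto
      then show "e' i \<bullet> (G *v e' j) = (if i = j then 1 else 0)"
      proof cases
        case 1
        then show ?thesis using orth by (simp add: e'_I)
      next
        case 2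
        then show ?thesis
          using insert.hyps xorth[of j] sym[of x "e j"]
          by (auto simp: e'_I) (simp add: e'_def)
      next
        case 3
        then show ?thesis
          using insert.hyps xorth[of i]
          by (auto simp: e'_I) (simp add: e'_def matrix_vector_mult_scaleR)
      next
        case 4
        then show ?thesis
          using r xpos by (simp add: e'_def matrix_vector_mult_scaleR)
      qed
    qed
    moreover have "e' ` insert k I \<subseteq> span (?a ` insert k I)"
    proof -
      have "span (?a ` I) \<subseteq> span (?a ` insert k I)"
        by (intro span_mono) auto
      moreover have "e' k \<in> span (?a ` insert k I)"
        using s_a calculation unfolding e'_def x_def
        by (auto intro!: span_scale span_diff intro: span_base)
      ultimately show ?thesis using e1 im by auto
    qed
    moreover have "?a ` insert k I \<subseteq> span (e' ` insert k I)"
    proof -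
      have sub: "span (e ` I) \<subseteq> span (e' ` insert k I)"
        using im by (intro span_mono) auto
      have "?a k = x + s" by (simp add: x_def)
      then have "?a k \<in> span (e' ` insert k I)"
        using x_span s_e sub by (auto intro!: span_add)
      then show ?thesis using e2 sub by auto
    qed
    ultimately show ?case by blast
  qed
  from this[of UNIV] obtain e :: "'n \<Rightarrow> real^'n"
    where orth: "\<And>i j. e i \<bullet> (G *v e j) = (if i = j then 1 else 0)"
      and e: "range ?a \<subseteq> span (range e)"
    by auto
  have "Basis \<subseteq> range ?a"
    by (auto simp: Basis_vec_def)
  then have span: "span (range e) = UNIV"
    by (metis (no_types) e span_Basis span_minimal subspace_span subset_trans top.extremum_uniqueI)
  define A :: "real^'n^'n" where "A = (\<chi> i. G *v e i)"
  have A: "(A *v v) $ i = e i \<bullet> (G *v v)" for v i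
    using sym[of v "e i"]
    by (simp add: A_def matrix_vector_mul_component inner_commute)
  have "(norm (A *v v))\<^sup>2 = v \<bullet> (G *v v)" for v
  proof -
    \<comment> \<open>The remainder of the expansion in \<open>e\<close> is
      \<open>G\<close>-orthogonal to every \<open>e i\<close>, hence to itself, and definiteness
      makes it zero.\<close>
    define w where "w = v - (\<Sum>i\<in>UNIV. (e i \<bullet> (G *v v)) *\<^sub>R e i)"
    have worth: "e i \<bullet> (G *v w) = 0" for i
    proof -
      have "e i \<bullet> (G *v w) = e i \<bullet> (G *v v) - (\<Sum>j\<in>UNIV. (e j \<bullet> (G *v v)) * (e i \<bullet> (G *v e j)))"
        by (simp add: w_def linear_sum[OF matrix_vector_mul_linear] inner_sum_right
            matrix_vector_mult_scaleR matrix_vector_mult_diff_distrib inner_diff_right)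
      then show ?thesis by (simp add: orth if_distrib cong: if_cong)
    qed
    have "z \<bullet> (G *v w) = 0" if "z \<in> span (range e)" for z
      using that
    proof (induction rule: span_induct)
      case base
      show ?case by (auto simp: subspace_def inner_left_distrib)
    next
      case (step x)
      then show ?case using worth by auto
    qed
    then have "w \<bullet> (G *v w) = 0" using span by simp
    then have "w = 0" using pos[of w] by fastforce
    then have v: "v = (\<Sum>i\<in>UNIV. (e i \<bullet> (G *v v)) *\<^sub>R e i)" by (simp add: w_def)
    have "(norm (A *v v))\<^sup>2 = (\<Sum>i\<in>UNIV. (e i \<bullet> (G *v v)) * (e i \<bullet> (G *v v)))"
      by (simp add: power2_norm_eq_inner inner_vec_def A)
    also have "\<dots> = (\<Sum>i\<in>UNIV. (e i \<bullet> (G *v v)) *\<^sub>R e i) \<bullet> (G *v v)"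
      by (simp add: inner_sum_left)
    also have "\<dots> = v \<bullet> (G *v v)" using v by simp
    finally show ?thesis .
  qed
  then show thesis by (rule that)
qed

text \<open>Homogeneous cone over \<open>D\<close> in coordinates centred at \<open>a\<close>: the
  ray through \<open>(t, y)\<close> stands for the point \<open>a + y / t\<close>. Centring puts a
  chosen base point at \<open>(1, 0)\<close>.\<close>

definition cone_at :: "real^'n \<Rightarrow> (real^'n) set \<Rightarrow> (real \<times> (real^'n)) set" where
  "cone_at a D = {(t, y). 0 < t \<and> a + (1/t) *\<^sub>R y \<in> D}"

lemma cone_at_iff: "(t, y) \<in> cone_at a D \<longleftrightarrow> 0 < t \<and> a + (1/t) *\<^sub>R y \<in> D"
  by (simp add: cone_at_def)

text \<open>On the connected set \<open>D\<close> the denominator has constant sign, so a change of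
  sign of the matrix sends lifts of points to positive multiples of lifts. Injectivity of
  \<open>f\<close> on an open set forces the linear map to be injective; together with surjectivity
  of \<open>f\<close> this gives the equivalence for arbitrary \<open>z\<close>.\<close>

lemma projective_automorphism_lift:
  fixes D :: "(real^'n) set"
  assumes D: "domain D" and f: "projective_automorphism D f"
  obtains m :: "real \<times> (real^'n) \<Rightarrow> real \<times> (real^'n)"
  where "linear m" "\<And>x. x \<in> D \<Longrightarrow> \<exists>\<tau>>0. m (1, x) = \<tau> *\<^sub>R (1, f x)"
    "\<And>z. m z \<in> cone_at 0 D \<longleftrightarrow> z \<in> cone_at 0 D"
proof -
  obtain c w b A where cwbA: "\<And>x. x \<in> D \<Longrightarrow> c + w \<bullet> x \<noteq> 0 \<and> f x = proj_fun c w b A x"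
    using f unfolding projective_automorphism_def projective_map_on_def by blast
  have bij: "bij_betw f D D" using f by (simp add: projective_automorphism_def)
  have op: "open D" and conn: "connected D" and ne: "D \<noteq> {}"
    using D by (auto simp: domain_def)
  define \<tau> where "\<tau> x = c + w \<bullet> x" for x
  have "connected (\<tau> ` D)"
    unfolding \<tau>_def by (intro connected_continuous_image continuous_intros conn)
  then have sgn: "(\<forall>x\<in>D. \<tau> x > 0) \<or> (\<forall>x\<in>D. \<tau> x < 0)"
    using connectedD_interval[of "\<tau> ` D" _ _ 0] cwbA unfolding \<tau>_def
    by (smt (verit, best) image_iff)
  define e :: real where "e = (if \<forall>x\<in>D. \<tau> x > 0 then 1 else -1)"
  have e: "e * \<tau> x > 0" if "x \<in> D" for x
    using sgn that by (auto simp: e_def)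
  define m where "m = (\<lambda>z::real \<times> (real^'n). e *\<^sub>R (c * fst z + w \<bullet> snd z, fst z *\<^sub>R b + A *v snd z))"
  have lin: "linear m"
    unfolding m_def
    by (rule linearI) (auto simp: algebra_simps inner_right_distrib matrix_vector_right_distrib
        matrix_vector_mult_scaleR)
  have m1: "m (1, x) = (e * \<tau> x) *\<^sub>R (1, f x)" if "x \<in> D" for x
    using cwbA[OF that] by (simp add: m_def \<tau>_def proj_fun_def)
  \<comment> \<open>For \<open>z = (t, v)\<close> in the kernel, \<open>(1, x)\<close> and
    \<open>(1, x) + s *\<^sub>R z\<close> have the same image. For small \<open>s > 0\<close> the
    second vector represents a point \<open>y s\<close> of \<open>D\<close>, so injectivity of
    \<open>f\<close> gives \<open>y s = x\<close>, that is \<open>v = t *\<^sub>R x\<close>. Two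
    different points \<open>x\<close> then force \<open>z = 0\<close>.\<close>
  have inj: "z = 0" if "m z = 0" for z
  proof -
    obtain t v where z: "z = (t, v)" by force
    have key: "v = t *\<^sub>R x" if x: "x \<in> D" for x
    proof -
      define y where "y s = (1 / (1 + s * t)) *\<^sub>R (x + s *\<^sub>R v)" for s
      have "(y \<longlongrightarrow> (1 / (1 + 0 * t)) *\<^sub>R (x + 0 *\<^sub>R v)) (at_right 0)"
        unfolding y_def by (intro tendsto_intros) auto
      then have "eventually (\<lambda>s. y s \<in> D) (at_right 0)"
        using op x by (intro topological_tendstoD) auto
      moreover have "((\<lambda>s. 1 + s * t) \<longlongrightarrow> 1 + 0 * t) (at_right 0)"
        by (intro tendsto_intros)
      then have "eventually (\<lambda>s. 1 + s * t > 0) (at_right 0)"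
        by (rule order_tendstoD) simp
      moreover have "eventually (\<lambda>s::real. s > 0) (at_right 0)"
        by (simp add: eventually_at_right_less)
      ultimately have "eventually (\<lambda>s. y s \<in> D \<and> 1 + s * t > 0 \<and> s > 0) (at_right 0)"
        by eventually_elim auto
      then obtain s where s: "y s \<in> D" "1 + s * t > 0" "s > 0"
        using eventually_happens trivial_limit_at_right_real by blast
      have "m (1, x) = m ((1, x) + s *\<^sub>R (t, v))"
        using lin that \<open>m z = 0\<close> z by (simp add: linear_add linear_scale del: scaleR_Pair add_Pair)
      also have "(1, x) + s *\<^sub>R (t, v) = (1 + s * t) *\<^sub>R (1, y s)"
        using s by (simp add: y_def)
      finally have "(e * \<tau> x) *\<^sub>R (1::real, f x) = (1 + s * t) *\<^sub>R (e * \<tau> (y s)) *\<^sub>R (1, f (y s))"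
        using m1[OF x] m1[OF s(1)] lin by (simp add: linear_scale del: scaleR_Pair add_Pair)
      then have "e * \<tau> x = (1 + s * t) * (e * \<tau> (y s))"
        "(e * \<tau> x) *\<^sub>R f x = ((1 + s * t) * (e * \<tau> (y s))) *\<^sub>R f (y s)"
        by simp_all
      then have "f x = f (y s)"
        using e[OF x] by (metis less_irrefl real_vector.scale_left_imp_eq)
      then have "x = y s"
        using bij x s by (auto simp: bij_betw_def inj_on_def)
      then have "(1 + s * t) *\<^sub>R x = (1 + s * t) *\<^sub>R y s" by simp
      then have "(1 + s * t) *\<^sub>R x = x + s *\<^sub>R v" using s by (simp add: y_def)
      then have "s *\<^sub>R v = s *\<^sub>R (t *\<^sub>R x)" by (simp add: algebra_simps)
      then show ?thesis using s(3) by (metis less_irrefl real_vector.scale_left_imp_eq)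
    qed
    obtain x where x: "x \<in> D" using ne by blast
    obtain r where r: "r > 0" "ball x r \<subseteq> D" using op x openE by blast
    define k where "k = (axis undefined 1 :: real^'n)"
    have k: "norm k = 1" by (simp add: k_def)
    have "x + (r/2) *\<^sub>R k \<in> D"
      using r k by (intro subsetD[OF r(2)]) (auto simp: dist_norm)
    from key[OF x] key[OF this] have "t *\<^sub>R ((r/2) *\<^sub>R k) = 0" by (simp add: algebra_simps)
    then have "t = 0" using r k by auto
    then show ?thesis using key[OF x] z by (simp add: zero_prod_def)
  qed
  have "m z \<in> cone_at 0 D \<longleftrightarrow> z \<in> cone_at 0 D" for z
  proof
    assume "z \<in> cone_at 0 D"
    then obtain t v where z: "z = (t, v)" and t: "t > 0" "(1/t) *\<^sub>R v \<in> D"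
      by (cases z) (auto simp: cone_at_iff)
    define x where "x = (1/t) *\<^sub>R v"
    have "z = t *\<^sub>R (1, x)" using t by (simp add: z x_def)
    then have "m z = (t * (e * \<tau> x)) *\<^sub>R (1, f x)"
      using m1[of x] t lin by (simp add: linear_scale x_def del: scaleR_Pair)
    moreover have "f x \<in> D" using bij t by (auto simp: bij_betw_def x_def)
    moreover have "t * (e * \<tau> x) > 0" using t e[of x] by (simp add: x_def)
    ultimately show "m z \<in> cone_at 0 D" by (auto simp: cone_at_iff)
  next
    assume "m z \<in> cone_at 0 D"
    then obtain t v where z: "m z = (t, v)" and t: "t > 0" "(1/t) *\<^sub>R v \<in> D"
      by (cases "m z") (auto simp: cone_at_iff)
    then obtain x where x: "x \<in> D" "f x = (1/t) *\<^sub>R v"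
      using bij by (metis bij_betw_imp_surj_on imageE)
    define k where "k = t / (e * \<tau> x)"
    have k: "k > 0" using e[OF x(1)] t by (simp add: k_def)
    have "m z = t *\<^sub>R (1, f x)" using t by (simp add: z x)
    also have "t = k * (e * \<tau> x)"
      using e[OF x(1)] by (auto simp: k_def)
    also have "\<dots> *\<^sub>R (1, f x) = k *\<^sub>R m (1, x)"
      by (simp add: m1[OF x(1)])
    finally have "m (z - k *\<^sub>R (1, x)) = 0"
      using lin by (simp add: linear_diff linear_scale del: scaleR_Pair)
    then have "z - k *\<^sub>R (1, x) = 0" by (rule inj)
    then have "z = (k, k *\<^sub>R x)" by simp
    then show "z \<in> cone_at 0 D" using k x by (simp add: cone_at_iff)
  qed
  with lin m1 e show thesis by (intro that) blast+
qed

text \<open>The lift is composed with the shears \<open>S\<close>, which recentre the affine chart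
  at \<open>q\<close> in the source and at an arbitrary \<open>a\<close> in the target; dividing by
  \<tau> normalises the image of \<open>(1, 0)\<close>.\<close>

lemma projective_automorphism_lift_at:
  fixes D :: "(real^'n) set"
  assumes D: "domain D" and f: "projective_automorphism D f" and q: "q \<in> D"
  obtains M :: "real \<times> (real^'n) \<Rightarrow> real \<times> (real^'n)"
  where "linear M" "M (1, 0) = (1, f q - a)" "\<And>z. M z \<in> cone_at a D \<longleftrightarrow> z \<in> cone_at q D"
proof -
  obtain m where m: "linear m" "\<And>x. x \<in> D \<Longrightarrow> \<exists>\<tau>>0. m (1, x) = \<tau> *\<^sub>R (1, f x)"
    "\<And>z. m z \<in> cone_at 0 D \<longleftrightarrow> z \<in> cone_at 0 D"
    using projective_automorphism_lift[OF D f] by blast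
  obtain \<tau> where \<tau>: "\<tau> > 0" "m (1, q) = \<tau> *\<^sub>R (1, f q)" using m(2)[OF q] by blast
  define S where "S = (\<lambda>(b::real^'n) z. (fst z :: real, snd z + fst z *\<^sub>R b))"
  have S: "linear (S b)" for b
    by (rule linearI) (auto simp: S_def algebra_simps)
  have S_cone: "S b z \<in> cone_at a' D \<longleftrightarrow> z \<in> cone_at (a' + b) D" for b a' z
    by (cases z) (auto simp: S_def cone_at_iff algebra_simps)
  define M where "M = (\<lambda>z. (1/\<tau>) *\<^sub>R S (-a) (m (S q z)))"
  have "linear M"
    unfolding M_def
    using linear_compose[OF linear_compose[OF S[of q] m(1)] S[of "-a"]]
    by (intro linear_compose_scale_right) (simp add: o_def)
  moreover have "M (1, 0) = (1, f q - a)"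
    using \<tau> by (simp add: M_def S_def algebra_simps)
  moreover have "M z \<in> cone_at a D \<longleftrightarrow> z \<in> cone_at q D" for z
  proof -
    have "(1/\<tau>) *\<^sub>R z \<in> cone_at a D \<longleftrightarrow> z \<in> cone_at a D" for z
      using \<tau> by (cases z) (auto simp: cone_at_iff zero_less_divide_iff)
    then show ?thesis
      by (simp add: M_def S_cone m(3))
  qed
  ultimately show thesis by (rule that)
qed

section \<open>The boundary near a strictly convex point\<close>

text \<open>The expansion point \<open>x\<close> varies while the Hessian stays frozen at
  \<open>p\<close>. The gradient minus the linear map \<open>N p\<close> has a derivative of norm at
  most \<epsilon> near \<open>p\<close>, so it is \<epsilon>-Lipschitz there, and the mean value
  theorem on the segment from \<open>x\<close> to \<open>y\<close> finishes.\<close>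

lemma uniform_taylor2:
  fixes \<sigma> :: "real^'n \<Rightarrow> real"
  assumes "open U" "p \<in> U"
    and \<sigma>: "\<And>x. x \<in> U \<Longrightarrow> (\<sigma> has_derivative (\<lambda>h. G x \<bullet> h)) (at x)"
    and G: "\<And>x. x \<in> U \<Longrightarrow> (G has_derivative (\<lambda>h. N x *v h)) (at x)"
    and N: "isCont N p" and "\<epsilon> > 0"
  obtains r where "r > 0" "ball p r \<subseteq> U"
    "\<And>x y. x \<in> ball p r \<Longrightarrow> y \<in> ball p r \<Longrightarrow>
      \<bar>\<sigma> y - \<sigma> x - G x \<bullet> (y - x) - (y - x) \<bullet> (N p *v (y - x)) / 2\<bar> \<le> \<epsilon> * (norm (y - x))\<^sup>2"
proof -
  define d where "d = real CARD('n)"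
  have d: "d > 0" by (simp add: d_def)
  obtain r1 where r1: "r1 > 0" "ball p r1 \<subseteq> U"
    using assms(1,2) openE by blast
  \<comment> \<open>A bound on the entries of a \<open>d\<close> by \<open>d\<close> matrix controls
    its operator norm up to the factor \<open>d * d\<close>.\<close>
  have "\<epsilon> / (d * d) > 0" using d \<open>\<epsilon> > 0\<close> by simp
  then obtain r2 where r2: "r2 > 0" "\<And>x. dist x p < r2 \<Longrightarrow> dist (N x) (N p) < \<epsilon> / (d * d)"
    using N unfolding continuous_at_eps_delta by blast
  define r where "r = min r1 r2"
  have r: "r > 0" "ball p r \<subseteq> U" using r1 r2 by (auto simp: r_def)
  have onorm_le: "onorm ((*v) (N x - N p)) \<le> \<epsilon>" if "x \<in> ball p r" for x
  proof -
    have "\<bar>(N x - N p) $ i $ j\<bar> \<le> \<epsilon> / (d * d)" for i j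
    proof -
      have "\<bar>(N x - N p) $ i $ j\<bar> \<le> norm ((N x - N p) $ i)"
        by (rule component_le_norm_cart)
      also have "\<dots> \<le> norm (N x - N p)" by (rule Finite_Cartesian_Product.norm_nth_le)
      also have "\<dots> \<le> \<epsilon> / (d * d)"
        using r2(2)[of x] that by (simp add: r_def dist_norm norm_minus_commute less_imp_le)
      finally show ?thesis .
    qed
    then have "onorm ((*v) (N x - N p)) \<le> d * d * (\<epsilon> / (d * d))"
      unfolding d_def by (rule onorm_le_matrix_component)
    then show ?thesis using d by simp
  qed
  define E where "E y = G y - N p *v y" for y
  have E: "(E has_derivative (\<lambda>h. (N x - N p) *v h)) (at x within ball p r)" if "x \<in> ball p r" for x
  proof -
    have "((\<lambda>y. G y - N p *v y) has_derivative (\<lambda>h. N x *v h - N p *v h)) (at x)"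
      by (rule has_derivative_diff[OF G bounded_linear_imp_has_derivative])
        (use that r in auto)
    then show ?thesis
      unfolding E_def[abs_def] matrix_vector_mult_diff_rdistrib by (rule has_derivative_at_withinI)
  qed
  have E_le: "norm (E y - E x) \<le> \<epsilon> * norm (y - x)" if "x \<in> ball p r" "y \<in> ball p r" for x y
    using differentiable_bound[OF convex_ball E onorm_le that(2,1)] by auto
  have "\<bar>\<sigma> y - \<sigma> x - G x \<bullet> (y - x) - (y - x) \<bullet> (N p *v (y - x)) / 2\<bar> \<le> \<epsilon> * (norm (y - x))\<^sup>2"
    if x: "x \<in> ball p r" and y: "y \<in> ball p r" for x y
  proof -
    define h where "h = y - x"
    have in_ball: "x + s *\<^sub>R h \<in> ball p r" if "0 \<le> s" "s \<le> 1" for s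
      using convexD_alt[OF convex_ball x y that] by (simp add: h_def algebra_simps)
    \<comment> \<open>The increment of \<psi> from 0 to 1 is the Taylor remainder, and its
      derivative only involves the difference of \<open>E\<close> at two points.\<close>
    define \<psi> where "\<psi> s = \<sigma> (x + s *\<^sub>R h) - s * (G x \<bullet> h) - s\<^sup>2 / 2 * (h \<bullet> (N p *v h))" for s
    have der: "(\<psi> has_real_derivative (E (x + s *\<^sub>R h) - E x) \<bullet> h) (at s)"
      if "0 \<le> s" "s \<le> 1" for s
    proof -
      have "x + s *\<^sub>R h \<in> U" using in_ball[OF that] r by blast
      have "((\<lambda>s. x + s *\<^sub>R h) has_derivative (\<lambda>k. k *\<^sub>R h)) (at s)"
        by (auto intro!: derivative_eq_intros)
      from has_derivative_compose[OF this, of \<sigma> "(\<bullet>) (G (x + s *\<^sub>R h))"] \<sigma>[OF \<open>x + s *\<^sub>R h \<in> U\<close>]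
      have "((\<lambda>s. \<sigma> (x + s *\<^sub>R h)) has_derivative (\<lambda>k. G (x + s *\<^sub>R h) \<bullet> (k *\<^sub>R h))) (at s)"
        by simp
      then have "((\<lambda>s. \<sigma> (x + s *\<^sub>R h)) has_real_derivative G (x + s *\<^sub>R h) \<bullet> h) (at s)"
        by (simp add: has_field_derivative_def mult_commute_abs)
      then show ?thesis
        unfolding \<psi>_def[abs_def] E_def
        by (auto intro!: derivative_eq_intros
            simp: algebra_simps inner_diff_left inner_diff_right inner_commute
              matrix_vector_right_distrib matrix_vector_mult_scaleR)
    qed
    obtain s where s: "0 < s" "s < 1" "\<psi> 1 - \<psi> 0 = (1 - 0) * ((E (x + s *\<^sub>R h) - E x) \<bullet> h)"
      using MVT2[of 0 1 \<psi>, OF _ der] by auto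
    have "\<bar>(E (x + s *\<^sub>R h) - E x) \<bullet> h\<bar> \<le> norm (E (x + s *\<^sub>R h) - E x) * norm h"
      by (rule Cauchy_Schwarz_ineq2)
    also have "\<dots> \<le> (\<epsilon> * norm (s *\<^sub>R h)) * norm h"
      using E_le[OF x in_ball[of s]] s by (intro mult_right_mono) auto
    also have "\<dots> \<le> (\<epsilon> * norm h) * norm h"
      using s \<open>\<epsilon> > 0\<close> by (intro mult_right_mono mult_left_mono) (auto simp: mult_left_le_one_le)
    finally have "\<bar>(E (x + s *\<^sub>R h) - E x) \<bullet> h\<bar> \<le> \<epsilon> * (norm h)\<^sup>2"
      by (simp add: power2_eq_square mult.assoc)
    moreover have "x + h = y" by (simp add: h_def)
    then have "(E (x + s *\<^sub>R h) - E x) \<bullet> h = \<sigma> y - \<sigma> x - G x \<bullet> h - h \<bullet> (N p *v h) / 2"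
      using s(3) by (simp add: \<psi>_def)
    ultimately show ?thesis unfolding h_def by simp
  qed
  with r show thesis by (intro that) auto
qed

text \<open>On the compact part of the unit sphere where the form is not positive,
  \<open>g \<bullet> h\<close> cannot vanish, so its square has a positive lower bound there and a
  large multiple of it restores positivity. Homogeneity gives the estimate for all
  \<open>h\<close>.\<close>

lemma posdef_on_hyperplane_add_square:
  fixes H :: "real^'n^'n" and g :: "real^'n"
  assumes pos: "\<And>v. v \<noteq> 0 \<Longrightarrow> g \<bullet> v = 0 \<Longrightarrow> v \<bullet> (H *v v) > 0"
  obtains K c where "K \<ge> 0" "c > 0" "\<And>h. c * (norm h)\<^sup>2 \<le> h \<bullet> (H *v h) / 2 + K * (g \<bullet> h)\<^sup>2"
proof -
  define f where "f h = h \<bullet> (H *v h)" for h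
  have contf: "continuous_on S f" for S
    unfolding f_def[abs_def] by (intro continuous_on_inner continuous_on_id linear_continuous_on matrix_vector_mul_bounded_linear)
  define S :: "(real^'n) set" where "S = sphere 0 1"
  have S: "compact S" "S \<noteq> {}" by (auto simp: S_def)
  obtain L where L: "\<And>h. h \<in> S \<Longrightarrow> - L \<le> f h" "L \<ge> 0"
  proof -
    obtain x where x: "x \<in> S" "\<And>h. h \<in> S \<Longrightarrow> f x \<le> f h"
      using continuous_attains_inf[OF S contf] by blast
    show ?thesis by (rule that[of "\<bar>f x\<bar>"]) (use x in force)+
  qed
  define Z where "Z = S \<inter> {h. f h \<le> 0}"
  have Z: "compact Z"
    unfolding Z_def using contf[of UNIV] S
    by (intro compact_Int_closed closed_Collect_le) auto
  obtain m where m: "m > 0" "\<And>h. h \<in> Z \<Longrightarrow> m \<le> (g \<bullet> h)\<^sup>2"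
  proof (cases "Z = {}")
    case True
    then show ?thesis by (intro that[of 1]) auto
  next
    case False
    have "continuous_on Z (\<lambda>h. (g \<bullet> h)\<^sup>2)" by (intro continuous_intros)
    then obtain x where x: "x \<in> Z" "\<And>h. h \<in> Z \<Longrightarrow> (g \<bullet> x)\<^sup>2 \<le> (g \<bullet> h)\<^sup>2"
      using continuous_attains_inf[OF Z False] by blast
    have "g \<bullet> x \<noteq> 0"
      using pos[of x] x(1) by (force simp: Z_def S_def f_def)
    then show ?thesis using x by (intro that[of "(g \<bullet> x)\<^sup>2"]) auto
  qed
  \<comment> \<open>On \<open>Z\<close> the added term is at least \<open>L + 1\<close>, while half
    the form can subtract at most \<open>L / 2\<close>.\<close>
  define K where "K = (L + 1) / m"
  have K: "K \<ge> 0" using m L by (simp add: K_def)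
  define F where "F h = f h / 2 + K * (g \<bullet> h)\<^sup>2" for h
  have Fpos: "F h > 0" if h: "h \<in> S" for h
  proof (cases "f h \<le> 0")
    case True
    then have "K * m \<le> K * (g \<bullet> h)\<^sup>2" using m h K by (intro mult_left_mono) (auto simp: Z_def)
    then have "L + 1 \<le> K * (g \<bullet> h)\<^sup>2" using m by (simp add: K_def)
    then show ?thesis using L(1)[OF h] L(2) unfolding F_def by linarith
  next
    case False
    then show ?thesis using K by (simp add: F_def add_pos_nonneg)
  qed
  have "continuous_on S F"
    unfolding F_def[abs_def] by (intro continuous_intros contf) auto
  then obtain x where x: "x \<in> S" "\<And>h. h \<in> S \<Longrightarrow> F x \<le> F h"
    using continuous_attains_inf[OF S] by blast
  have "F x * (norm h)\<^sup>2 \<le> h \<bullet> (H *v h) / 2 + K * (g \<bullet> h)\<^sup>2" for h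
  proof (cases "h = 0")
    case True
    then show ?thesis by simp
  next
    case False
    define u where "u = (1 / norm h) *\<^sub>R h"
    have u: "u \<in> S" "h = norm h *\<^sub>R u" using False by (auto simp: u_def S_def)
    have "h \<bullet> (H *v h) / 2 + K * (g \<bullet> h)\<^sup>2 = (norm h)\<^sup>2 * F u"
      by (subst (1 2 3) u(2)) (simp add: F_def f_def matrix_vector_mult_scaleR power2_eq_square algebra_simps)
    moreover have "(norm h)\<^sup>2 * F x \<le> (norm h)\<^sup>2 * F u"
      using x(2)[OF u(1)] by (intro mult_left_mono) auto
    ultimately show ?thesis by (simp add: mult.commute)
  qed
  with K Fpos[OF x(1)] show thesis by (intro that)
qed

text \<open>Here \<open>G\<close> is the gradient of \<open>\<sigma>\<close> and \<open>P\<close> is half its Hessian at \<open>p\<close>; the Taylor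
  estimate at all points near \<open>p\<close> uses this one fixed form.\<close>

locale osculated_boundary =
  fixes D :: "(real^'n) set" and p :: "real^'n" and \<sigma> :: "real^'n \<Rightarrow> real"
    and G :: "real^'n \<Rightarrow> real^'n" and P :: "real^'n^'n" and c C r0 :: real
  assumes r0: "0 < r0" and c: "0 < c"
    and P_lower: "\<And>h. c * (norm h)\<^sup>2 \<le> h \<bullet> (P *v h)"
    and P_upper: "\<And>h. h \<bullet> (P *v h) \<le> C * (norm h)\<^sup>2"
    and G_p: "G p \<noteq> 0" and G_cont: "isCont G p"
    and \<sigma>_cont: "continuous_on (ball p r0) \<sigma>"
    and D_iff: "\<And>x. x \<in> ball p r0 \<Longrightarrow> x \<in> D \<longleftrightarrow> \<sigma> x < 0"
    and taylor: "\<And>\<epsilon>. \<epsilon> > 0 \<Longrightarrow> \<exists>r>0. r \<le> r0 \<and> (\<forall>x\<in>ball p r. \<forall>y\<in>ball p r.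
      \<bar>\<sigma> y - \<sigma> x - G x \<bullet> (y - x) - (y - x) \<bullet> (P *v (y - x))\<bar> \<le> \<epsilon> * ((y - x) \<bullet> (P *v (y - x))))"
    and open_D: "open D" and p_frontier: "p \<in> frontier D"

text \<open>At \<open>p\<close>, where \<rho> vanishes, the function \<sigma> = \<rho> + K \<rho>^2
  has the same gradient as \<rho>, and its Hessian gains \<open>2 * K\<close> times the rank one
  form given by \<open>g p\<close>. This is the square that makes half the Hessian positive
  definite.\<close>

lemma strictly_convex_imp_osculated:
  fixes D :: "(real^'n) set"
  assumes "strictly_convex_boundary_point D p" and "open D"
  obtains \<sigma> G P c C r0 where "osculated_boundary D p \<sigma> G P c C r0"
proof -
  obtain U \<rho> g H where U: "open U" "p \<in> U" and pf: "p \<in> frontier D"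
    and \<rho>: "\<And>x. x \<in> U \<Longrightarrow> (\<rho> has_derivative (\<lambda>h. g x \<bullet> h)) (at x)"
    and g: "\<And>x. x \<in> U \<Longrightarrow> (g has_derivative (\<lambda>h. H x *v h)) (at x)"
    and H: "continuous_on U H"
    and DU: "D \<inter> U = {x\<in>U. \<rho> x < 0}" and gp: "g p \<noteq> 0"
    and pos: "\<And>v. v \<noteq> 0 \<Longrightarrow> g p \<bullet> v = 0 \<Longrightarrow> v \<bullet> (H p *v v) > 0"
    using assms(1) unfolding strictly_convex_boundary_point_def by blast
  obtain K c where K: "K \<ge> 0" and c: "c > 0"
    and low: "\<And>h. c * (norm h)\<^sup>2 \<le> h \<bullet> (H p *v h) / 2 + K * (g p \<bullet> h)\<^sup>2"
    using posdef_on_hyperplane_add_square[of "g p" "H p"] pos by blast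
  have \<rho>_cont: "continuous_on U \<rho>"
    using \<rho> has_derivative_continuous U by (meson continuous_at_imp_continuous_on)
  have \<rho>p: "\<rho> p = 0"
  proof (rule ccontr)
    assume "\<rho> p \<noteq> 0"
    then consider "\<rho> p < 0" | "\<rho> p > 0" by linarith
    then show False
    proof cases
      case 1
      then have "p \<in> D" using DU U by blast
      then show False using pf \<open>open D\<close> by (simp add: frontier_def interior_open)
    next
      case 2
      have "open (U \<inter> \<rho> -` {0<..})"
        using continuous_open_preimage[OF \<rho>_cont U(1) open_greaterThan] .
      moreover have "p \<in> U \<inter> \<rho> -` {0<..}" using 2 U by auto
      moreover have "p \<in> closure D" using pf by (simp add: frontier_def)
      ultimately obtain x where "x \<in> D" "x \<in> U" "\<rho> x > 0"
        using open_Int_closure_eq_empty[of "U \<inter> \<rho> -` {0<..}" D] by blast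
      moreover from this have "x \<in> {x \<in> U. \<rho> x < 0}" using DU by blast
      ultimately show False by simp
    qed
  qed
  have "isCont \<rho> p" using \<rho>[OF U(2)] by (rule has_derivative_continuous)
  moreover have "1 / (K + 1) > 0" using K by simp
  \<comment> \<open>This bound makes \<open>1 + K * \<rho> x\<close> positive, so \<sigma> = \<rho>
    (1 + K \<rho>) has the sign of \<rho> and also defines \<open>D\<close> near
    \<open>p\<close>.\<close>
  ultimately obtain r1 where r1: "r1 > 0" "\<And>x. dist x p < r1 \<Longrightarrow> \<bar>\<rho> x\<bar> < 1 / (K + 1)"
    unfolding continuous_at_eps_delta \<rho>p dist_real_def by (metis diff_zero)
  obtain r2 where r2: "r2 > 0" "ball p r2 \<subseteq> U" using U openE by blast
  define r0 where "r0 = min r1 r2"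
  have r0: "r0 > 0" "ball p r0 \<subseteq> U" using r1 r2 by (auto simp: r0_def)
  define \<sigma> where "\<sigma> x = \<rho> x + K * (\<rho> x)\<^sup>2" for x
  define G where "G x = (1 + 2 * K * \<rho> x) *\<^sub>R g x" for x
  define N :: "real^'n \<Rightarrow> real^'n^'n"
    where "N x = (1 + 2 * K * \<rho> x) *\<^sub>R H x + (2 * K) *\<^sub>R (\<chi> i j. g x $ i * g x $ j)" for x
  define P where "P = (1/2) *\<^sub>R N p"
  have outer: "(\<chi> i j. a $ i * a $ j) *v h = (a \<bullet> h) *\<^sub>R a" for a h :: "real^'n"
    by (simp add: matrix_vector_mult_def inner_vec_def vec_eq_iff sum_distrib_left mult_ac)
  have N_app: "N x *v h = (1 + 2 * K * \<rho> x) *\<^sub>R (H x *v h) + (2 * K * (g x \<bullet> h)) *\<^sub>R g x" for x h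
    by (simp add: N_def matrix_vector_mult_add_rdistrib outer scaleR_matrix_vector_assoc[symmetric])
  have P_app: "P *v h = (1/2) *\<^sub>R (N p *v h)" for h
    by (simp add: P_def scaleR_matrix_vector_assoc[symmetric])
  have P_low: "c * (norm h)\<^sup>2 \<le> h \<bullet> (P *v h)" for h
    using low[of h]
    by (simp add: P_app N_app \<rho>p inner_add_right power2_eq_square inner_commute algebra_simps)
  have \<sigma>_der: "(\<sigma> has_derivative (\<lambda>h. G x \<bullet> h)) (at x)" if "x \<in> U" for x
    unfolding \<sigma>_def[abs_def] G_def
    by (auto intro!: derivative_eq_intros \<rho>[OF that] simp: algebra_simps fun_eq_iff)
  have G_der: "(G has_derivative (\<lambda>h. N x *v h)) (at x)" if "x \<in> U" for x
    unfolding G_def[abs_def] N_app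
    by (auto intro!: derivative_eq_intros \<rho>[OF that] g[OF that] simp: algebra_simps fun_eq_iff)
  have "isCont H p" using H U by (simp add: continuous_on_eq_continuous_at)
  moreover have "isCont g p" using g[OF U(2)] by (rule has_derivative_continuous)
  ultimately
  have N_cont: "isCont N p"
    unfolding N_def[abs_def] using \<open>isCont \<rho> p\<close> unfolding isCont_def
    by (intro tendsto_intros tendsto_vec_lambda)
  have "osculated_boundary D p \<sigma> G P c (onorm ((*v) P)) r0"
  proof
    show "0 < r0" "0 < c" "open D" "p \<in> frontier D" by fact+
    show "c * (norm h)\<^sup>2 \<le> h \<bullet> (P *v h)" for h by (rule P_low)
    show "h \<bullet> (P *v h) \<le> onorm ((*v) P) * (norm h)\<^sup>2" for h
    proof -
      have "h \<bullet> (P *v h) \<le> norm h * norm (P *v h)" by (rule norm_cauchy_schwarz)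
      also have "\<dots> \<le> norm h * (onorm ((*v) P) * norm h)"
        by (intro mult_left_mono onorm) auto
      finally show ?thesis by (simp add: power2_eq_square algebra_simps)
    qed
    show "G p \<noteq> 0" using gp by (simp add: G_def \<rho>p)
    show "isCont G p" using G_der[OF U(2)] by (rule has_derivative_continuous)
    show "continuous_on (ball p r0) \<sigma>"
      unfolding \<sigma>_def[abs_def] using r0 continuous_on_subset[OF \<rho>_cont] by (intro continuous_intros) auto
    show "x \<in> D \<longleftrightarrow> \<sigma> x < 0" if x: "x \<in> ball p r0" for x
    proof -
      have "\<bar>\<rho> x\<bar> < 1 / (K + 1)" using x r1(2)[of x] by (simp add: r0_def dist_commute)
      then have "\<bar>\<rho> x\<bar> * (K + 1) < 1" using K by (simp add: field_simps)
      moreover have "\<bar>K * \<rho> x\<bar> \<le> \<bar>\<rho> x\<bar> * (K + 1)" using K by (simp add: abs_mult algebra_simps)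
      ultimately have "1 + K * \<rho> x > 0" by linarith
      moreover have "\<sigma> x = \<rho> x * (1 + K * \<rho> x)" by (simp add: \<sigma>_def power2_eq_square algebra_simps)
      ultimately have "\<sigma> x < 0 \<longleftrightarrow> \<rho> x < 0" by (simp add: mult_less_0_iff)
      moreover have "x \<in> U" using x r0 by blast
      ultimately show ?thesis using DU by blast
    qed
    show "\<exists>r>0. r \<le> r0 \<and> (\<forall>x\<in>ball p r. \<forall>y\<in>ball p r.
      \<bar>\<sigma> y - \<sigma> x - G x \<bullet> (y - x) - (y - x) \<bullet> (P *v (y - x))\<bar> \<le> \<epsilon> * ((y - x) \<bullet> (P *v (y - x))))"
      if "\<epsilon> > 0" for \<epsilon>
    proof -
      \<comment> \<open>The factor \<open>c\<close> turns an error measured by the squared norm into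
        one measured by the form \<open>P\<close>.\<close>
      have "\<epsilon> * c > 0" using that c by simp
      then obtain r where r: "r > 0" "ball p r \<subseteq> U"
        "\<And>x y. x \<in> ball p r \<Longrightarrow> y \<in> ball p r \<Longrightarrow>
          \<bar>\<sigma> y - \<sigma> x - G x \<bullet> (y - x) - (y - x) \<bullet> (N p *v (y - x)) / 2\<bar> \<le> (\<epsilon> * c) * (norm (y - x))\<^sup>2"
        using uniform_taylor2[OF U \<sigma>_der G_der N_cont] by blast
      have "\<bar>\<sigma> y - \<sigma> x - G x \<bullet> (y - x) - (y - x) \<bullet> (P *v (y - x))\<bar> \<le> \<epsilon> * ((y - x) \<bullet> (P *v (y - x)))"
        if "x \<in> ball p r" "y \<in> ball p r" for x y
      proof -
        have "(\<epsilon> * c) * (norm (y - x))\<^sup>2 \<le> \<epsilon> * ((y - x) \<bullet> (P *v (y - x)))"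
          using mult_left_mono[OF P_low[of "y - x"], of \<epsilon>] \<open>\<epsilon> > 0\<close> by (simp add: mult.assoc)
        then show ?thesis using r(3)[OF that] by (simp add: P_app)
      qed
      then show ?thesis using r(1) r0 by (intro exI[of _ "min r r0"]) auto
    qed
  qed
  then show thesis by (rule that)
qed

section \<open>Orbits, convexity and outer bounds\<close>

lemma cone_at_combination:
  assumes "closed_segment x y \<subseteq> D" "0 \<le> a" "0 \<le> b" "0 < a + b"
  shows "a *\<^sub>R (1, x) + b *\<^sub>R (1, y) \<in> cone_at 0 D"
proof -
  have "1 - b / (a + b) = a / (a + b)" using assms by (simp add: field_simps)
  then have "(1 / (a + b)) *\<^sub>R (a *\<^sub>R x + b *\<^sub>R y) = (1 - b / (a + b)) *\<^sub>R x + (b / (a + b)) *\<^sub>R y"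
    by (simp add: scaleR_add_right)
  also have "\<dots> \<in> closed_segment x y"
    using assms by (auto simp: in_segment intro!: exI[of _ "b / (a + b)"])
  finally show ?thesis using assms by (auto simp: cone_at_iff)
qed

lemma add_in_ball:
  fixes p :: "'a::real_normed_vector"
  assumes "dist x p + norm k < r"
  shows "x + k \<in> ball p r" "x - k \<in> ball p r"
proof -
  have "norm (x - p + k) < r" "norm (x - p - k) < r"
    using assms norm_triangle_ineq[of "x - p" k] norm_triangle_ineq4[of "x - p" k]
    by (auto simp: dist_norm)
  moreover have "x + k - p = x - p + k" "x - k - p = x - p - k" by simp_all
  ultimately show "x + k \<in> ball p r" "x - k \<in> ball p r"
    by (metis dist_commute dist_norm mem_ball)+
qed

lemma cone_at_1_iff: "(1, x) \<in> cone_at 0 D \<longleftrightarrow> x \<in> D"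
  by (simp add: cone_at_iff)

text \<open>The lift sends \<open>(1, x)\<close> and \<open>(1, y)\<close> to positive multiples of
  the lifts of \<open>f x\<close> and \<open>f y\<close>, so a point of the segment lands in the
  cone over the image segment; the lift also reflects membership in the cone.\<close>

lemma automorphism_segment_pullback:
  fixes D :: "(real^'n) set"
  assumes "domain D" "projective_automorphism D f" and x: "x \<in> D" and y: "y \<in> D"
    and seg: "closed_segment (f x) (f y) \<subseteq> D"
  shows "closed_segment x y \<subseteq> D"
proof
  fix z assume "z \<in> closed_segment x y"
  then obtain u where u: "0 \<le> u" "u \<le> 1" "z = (1 - u) *\<^sub>R x + u *\<^sub>R y"
    by (auto simp: in_segment)
  obtain m where m: "linear m" "\<And>x. x \<in> D \<Longrightarrow> \<exists>\<tau>>0. m (1, x) = \<tau> *\<^sub>R (1, f x)"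
    "\<And>z. m z \<in> cone_at 0 D \<longleftrightarrow> z \<in> cone_at 0 D"
    using projective_automorphism_lift[OF assms(1,2)] by blast
  obtain \<tau> \<tau>' where \<tau>: "\<tau> > 0" "m (1, x) = \<tau> *\<^sub>R (1, f x)" "\<tau>' > 0" "m (1, y) = \<tau>' *\<^sub>R (1, f y)"
    using m(2)[OF x] m(2)[OF y] by blast
  have "(1, z) = (1 - u) *\<^sub>R (1::real, x) + u *\<^sub>R (1, y)" using u by simp
  then have "m (1, z) = ((1 - u) * \<tau>) *\<^sub>R (1, f x) + (u * \<tau>') *\<^sub>R (1, f y)"
    using m(1) \<tau> by (simp add: linear_add linear_scale del: scaleR_Pair add_Pair)
  moreover have "(1 - u) * \<tau> + u * \<tau>' > 0"
    using u \<tau> by (cases "u = 0") (auto intro!: add_nonneg_pos)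
  ultimately have "m (1, z) \<in> cone_at 0 D"
    using u \<tau> cone_at_combination[OF seg, of "(1 - u) * \<tau>" "u * \<tau>'"] by simp
  then show "z \<in> D" using m(3) cone_at_1_iff by blast
qed

text \<open>If a segment of \<open>D\<close> around \<open>x\<close> reaches twice as far as \<open>x + w\<close>, then the image of
  \<open>x + w\<close> is at most twice as far from \<open>f x\<close> as the boundary of \<open>D\<close> along that line.\<close>

lemma automorphism_chord:
  fixes D :: "(real^'n) set"
  assumes "domain D" "projective_automorphism D f"
    and seg: "closed_segment (x - 2 *\<^sub>R w) (x + 2 *\<^sub>R w) \<subseteq> D" and s: "0 \<le> s" "s \<le> 1/2"
  shows "f x + s *\<^sub>R (f (x + w) - f x) \<in> D" "f x - s *\<^sub>R (f (x + w) - f x) \<in> D"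
proof -
  have in_seg: "x + u *\<^sub>R w \<in> closed_segment (x - 2 *\<^sub>R w) (x + 2 *\<^sub>R w)" if "-2 \<le> u" "u \<le> 2" for u
  proof -
    have "x + u *\<^sub>R w = (1 - (u + 2) / 4) *\<^sub>R (x - 2 *\<^sub>R w) + ((u + 2) / 4) *\<^sub>R (x + 2 *\<^sub>R w)"
      by (simp add: vec_eq_iff field_simps)
    then show ?thesis using that unfolding in_segment by (intro exI[of _ "(u + 2) / 4"]) auto
  qed
  have in_D: "x + u *\<^sub>R w \<in> D" if "-2 \<le> u" "u \<le> 2" for u
    using in_seg[OF that] seg by blast
  obtain m where m: "linear m" "\<And>x. x \<in> D \<Longrightarrow> \<exists>\<tau>>0. m (1, x) = \<tau> *\<^sub>R (1, f x)"
    "\<And>z. m z \<in> cone_at 0 D \<longleftrightarrow> z \<in> cone_at 0 D"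
    using projective_automorphism_lift[OF assms(1,2)] by blast
  define T where "T u = fst (m (1, x + u *\<^sub>R w))" for u
  have T: "T u > 0" "m (1, x + u *\<^sub>R w) = T u *\<^sub>R (1, f (x + u *\<^sub>R w))" if "-2 \<le> u" "u \<le> 2" for u
    using m(2)[OF in_D[OF that]] by (auto simp: T_def)
  have T_affine: "T u = T 0 + u * fst (m (0, w))" for u
  proof -
    have "(1, x + u *\<^sub>R w) = (1, x) + u *\<^sub>R (0::real, w)" by simp
    then show ?thesis using m(1) by (simp add: T_def linear_add linear_scale del: scaleR_Pair add_Pair)
  qed
  define \<gamma> where "\<gamma> = T 0"
  define \<mu> where "\<mu> = T 1"
  have \<gamma>: "\<gamma> > 0" "m (1, x) = \<gamma> *\<^sub>R (1, f x)" using T[of 0] by (auto simp: \<gamma>_def)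
  have \<mu>: "\<mu> > 0" "m (1, x + w) = \<mu> *\<^sub>R (1, f (x + w))" using T[of 1] by (auto simp: \<mu>_def)
  \<comment> \<open>The denominator is affine along the line and equals
    \<open>2 * \<mu> - \<gamma>\<close> at the end \<open>x + 2 *\<^sub>R w\<close>, where it is
    positive.\<close>
  have "\<gamma> < 2 * \<mu>"
    using T(1)[of 2] by (simp add: \<mu>_def \<gamma>_def T_affine[of 2] T_affine[of 1])
  have in_D': "f x + u *\<^sub>R (f (x + w) - f x) \<in> D" if u: "-1/2 \<le> u" "u \<le> 1/2" for u
  proof -
    \<comment> \<open>Dividing the weights by the denominators gives the preimage
      \<open>t *\<^sub>R (1, x + k *\<^sub>R w)\<close> of the lifted point. For either sign of
      \<open>u\<close> it remains to see that \<open>t\<close> is positive and that \<open>k\<close>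
      stays in the parameter range of the given segment.\<close>
    define t where "t = (1 - u) / \<gamma> + u / \<mu>"
    have ineq: "u / \<mu> \<ge> -2 * \<bar>u\<bar> / \<gamma>" "\<bar>u\<bar> / \<mu> \<le> 2 * \<bar>u\<bar> / \<gamma>"
    proof -
      have "1 / \<mu> \<le> 2 / \<gamma>" using \<gamma> \<mu> \<open>\<gamma> < 2 * \<mu>\<close> by (simp add: field_simps)
      then have "\<bar>u\<bar> * (1 / \<mu>) \<le> \<bar>u\<bar> * (2 / \<gamma>)" by (rule mult_left_mono) simp
      then show *: "\<bar>u\<bar> / \<mu> \<le> 2 * \<bar>u\<bar> / \<gamma>" by (simp add: mult.commute)
      have "u / \<mu> \<ge> - (\<bar>u\<bar> / \<mu>)" using \<mu> by (simp add: field_simps)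
      with * show "u / \<mu> \<ge> -2 * \<bar>u\<bar> / \<gamma>" by simp
    qed
    have t: "t > 0 \<and> \<bar>u\<bar> / \<mu> \<le> 2 * t"
    proof (cases "u \<ge> 0")
      case True
      moreover have "(1 - u) / \<gamma> > 0" using u \<gamma> by simp
      moreover have "u / \<mu> \<ge> 0" using True \<mu> by simp
      ultimately have "t > 0" "u / \<mu> \<le> 2 * t" unfolding t_def distrib_left by linarith+
      then show ?thesis using True by simp
    next
      case False
      have "t \<ge> (1 - u) / \<gamma> + 2 * u / \<gamma>" using ineq(1) False by (simp add: t_def)
      also have "(1 - u) / \<gamma> + 2 * u / \<gamma> = (1 + u) / \<gamma>" by (simp add: add_divide_distrib diff_divide_distrib)
      finally have t1: "t \<ge> (1 + u) / \<gamma>" .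
      moreover have "(1 + u) / \<gamma> > 0" using u \<gamma> by simp
      moreover have "2 * \<bar>u\<bar> / \<gamma> \<le> 2 * ((1 + u) / \<gamma>)" using False u \<gamma> by (simp add: field_simps)
      ultimately show ?thesis using ineq(2) by linarith
    qed
    define k where "k = u / \<mu> / t"
    have "\<bar>k\<bar> \<le> 2" using t \<mu> by (simp add: k_def abs_mult field_simps)
    then have "x + k *\<^sub>R w \<in> D" by (intro in_D) auto
    then have "m (t *\<^sub>R (1, x + k *\<^sub>R w)) \<in> cone_at 0 D"
      using t by (simp add: m(3) cone_at_iff)
    also have "t *\<^sub>R (1, x + k *\<^sub>R w) = ((1 - u) / \<gamma>) *\<^sub>R (1, x) + (u / \<mu>) *\<^sub>R (1, x + w)"
      using t by (simp add: k_def algebra_simps t_def[symmetric]) (simp add: t_def algebra_simps)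
    also have "m \<dots> = (1 - u) *\<^sub>R (1, f x) + u *\<^sub>R (1, f (x + w))"
      using m(1) \<gamma> \<mu> by (simp add: linear_add linear_scale del: scaleR_Pair add_Pair)
    also have "\<dots> = (1, f x + u *\<^sub>R (f (x + w) - f x))"
      by (simp add: algebra_simps)
    finally show ?thesis by (simp add: cone_at_1_iff)
  qed
  show "f x + s *\<^sub>R (f (x + w) - f x) \<in> D" "f x - s *\<^sub>R (f (x + w) - f x) \<in> D"
    using in_D'[of s] in_D'[of "-s"] s by auto
qed

section \<open>Boundary geometry near \<open>p\<close>, attraction of orbits, outer quadrics\<close>

context osculated_boundary
begin

definition Q :: "real^'n \<Rightarrow> real" where "Q h = h \<bullet> (P *v h)"

lemma Q_lower: "c * (norm h)\<^sup>2 \<le> Q h" and Q_upper: "Q h \<le> C * (norm h)\<^sup>2"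
  using P_lower P_upper by (auto simp: Q_def)

lemma Q_nonneg: "0 \<le> Q h"
  using Q_lower[of h] c by (smt (verit) mult_nonneg_nonneg zero_le_power2)

lemma Q_scale: "Q (s *\<^sub>R h) = s\<^sup>2 * Q h"
  by (simp add: Q_def matrix_vector_mult_scaleR power2_eq_square)

lemma taylor_Q:
  assumes "\<epsilon> > 0"
  obtains r where "r > 0" "r \<le> r0" "\<And>x h. x \<in> ball p r \<Longrightarrow> x + h \<in> ball p r \<Longrightarrow>
    \<bar>\<sigma> (x + h) - \<sigma> x - G x \<bullet> h - Q h\<bar> \<le> \<epsilon> * Q h"
proof -
  obtain r where r: "r > 0" "r \<le> r0" and *: "\<And>x y. x \<in> ball p r \<Longrightarrow> y \<in> ball p r \<Longrightarrow>
      \<bar>\<sigma> y - \<sigma> x - G x \<bullet> (y - x) - (y - x) \<bullet> (P *v (y - x))\<bar> \<le> \<epsilon> * ((y - x) \<bullet> (P *v (y - x)))"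
    using taylor[OF assms] by blast
  show thesis
  proof (rule that[OF r])
    fix x h assume "x \<in> ball p r" "x + h \<in> ball p r"
    from *[OF this] show "\<bar>\<sigma> (x + h) - \<sigma> x - G x \<bullet> h - Q h\<bar> \<le> \<epsilon> * Q h"
      by (simp add: Q_def)
  qed
qed

lemma frontier_notin: "a \<in> frontier D \<Longrightarrow> a \<notin> D"
  using open_D by (simp add: frontier_def interior_open)

lemma \<sigma>_frontier:
  assumes "a \<in> frontier D" "a \<in> ball p r0"
  shows "\<sigma> a = 0"
proof (rule antisym)
  show "0 \<le> \<sigma> a" using frontier_notin D_iff assms by force
  show "\<sigma> a \<le> 0"
  proof (rule ccontr)
    assume "\<not> \<sigma> a \<le> 0"
    then have "a \<in> ball p r0 \<inter> \<sigma> -` {0<..}" using assms by auto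
    moreover have "open (ball p r0 \<inter> \<sigma> -` {0<..})"
      using continuous_open_preimage[OF \<sigma>_cont open_ball open_greaterThan] .
    moreover have "a \<in> closure D" using assms by (simp add: frontier_def)
    ultimately obtain x where "x \<in> D" "x \<in> ball p r0" "\<sigma> x > 0"
      using open_Int_closure_eq_empty[of "ball p r0 \<inter> \<sigma> -` {0<..}" D] by blast
    then show False using D_iff by force
  qed
qed

lemma \<sigma>_p: "\<sigma> p = 0"
  using \<sigma>_frontier p_frontier r0 by simp

lemma \<sigma>_isCont: "isCont \<sigma> p"
  using \<sigma>_cont r0 by (simp add: continuous_on_eq_continuous_at)

text \<open>Adding the Taylor estimates for \<open>h\<close> and \<open>-h\<close> cancels the
  gradient term. Hence a chord of \<open>D\<close> near \<open>p\<close> with midpoint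
  \<open>x\<close> is short when \<open>\<sigma> x\<close> is close to 0.\<close>

lemma two_sided_bound:
  obtains r where "r > 0" "r \<le> r0"
    "\<And>x h. \<lbrakk>x \<in> ball p r; x + h \<in> ball p r; x - h \<in> ball p r; x + h \<in> D; x - h \<in> D\<rbrakk> \<Longrightarrow>
      c * (norm h)\<^sup>2 < - 2 * \<sigma> x"
proof -
  obtain r where r: "r > 0" "r \<le> r0" and *: "\<And>x h. x \<in> ball p r \<Longrightarrow> x + h \<in> ball p r \<Longrightarrow>
    \<bar>\<sigma> (x + h) - \<sigma> x - G x \<bullet> h - Q h\<bar> \<le> (1/2) * Q h"
    using taylor_Q[of "1/2"] by auto
  show thesis
  proof (rule that[OF r])
    fix x h assume h: "x \<in> ball p r" "x + h \<in> ball p r" "x - h \<in> ball p r" "x + h \<in> D" "x - h \<in> D"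
    have "\<sigma> (x + h) < 0" "\<sigma> (x - h) < 0" using D_iff h r by auto
    moreover have "Q (- h) = Q h" using Q_scale[of "-1" h] by simp
    ultimately have "Q h < - 2 * \<sigma> x"
      using abs_le_D2[OF *[of x h]] abs_le_D2[OF *[of x "-h"]] h by simp
    then show "c * (norm h)\<^sup>2 < - 2 * \<sigma> x" using Q_lower[of h] by linarith
  qed
qed

text \<open>With error factor 1 the Taylor estimate keeps \<sigma> above its tangent planes. The
  tangent plane at an intermediate point then bounds \<sigma> there by the weighted mean of its
  values at the ends.\<close>

lemma local_convex:
  obtains r where "r > 0" "r \<le> r0" "convex (D \<inter> ball p r)"
proof -
  obtain r where r: "r > 0" "r \<le> r0" and *: "\<And>x h. x \<in> ball p r \<Longrightarrow> x + h \<in> ball p r \<Longrightarrow>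
    \<bar>\<sigma> (x + h) - \<sigma> x - G x \<bullet> h - Q h\<bar> \<le> 1 * Q h"
    using taylor_Q[of 1] by auto
  have above: "\<sigma> x + G x \<bullet> (y - x) \<le> \<sigma> y" if "x \<in> ball p r" "y \<in> ball p r" for x y
    using *[of x "y - x"] that by auto
  have "convex (D \<inter> ball p r)"
    unfolding convex_alt
  proof (intro ballI allI impI)
    fix x y and u :: real
    assume x: "x \<in> D \<inter> ball p r" and y: "y \<in> D \<inter> ball p r" and u: "0 \<le> u \<and> u \<le> 1"
    define z where "z = (1 - u) *\<^sub>R x + u *\<^sub>R y"
    have z: "z \<in> ball p r"
      using convexD_alt[OF convex_ball, of x p r y u] x y u by (auto simp: z_def)
    have "(1 - u) * (\<sigma> z + G z \<bullet> (x - z)) + u * (\<sigma> z + G z \<bullet> (y - z)) \<le> (1 - u) * \<sigma> x + u * \<sigma> y"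
      using above[OF z] x y u by (intro add_mono mult_left_mono) auto
    moreover have "(1 - u) * (G z \<bullet> (x - z)) + u * (G z \<bullet> (y - z)) = 0"
    proof -
      have "(1 - u) *\<^sub>R (x - z) + u *\<^sub>R (y - z) = 0" by (simp add: z_def algebra_simps)
      then have "G z \<bullet> ((1 - u) *\<^sub>R (x - z) + u *\<^sub>R (y - z)) = 0" by simp
      then show ?thesis by (simp add: inner_add_right)
    qed
    moreover have "\<sigma> x < 0" "\<sigma> y < 0" using D_iff x y r by auto
    then have "(1 - u) * \<sigma> x + u * \<sigma> y < 0"
      using u by (cases "u = 0") (auto intro!: add_nonpos_neg simp: mult_nonneg_nonpos mult_pos_neg)
    ultimately have "\<sigma> z < 0" by (simp add: algebra_simps)
    then show "(1 - u) *\<^sub>R x + u *\<^sub>R y \<in> D \<inter> ball p r"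
      using D_iff z r by (auto simp: z_def)
  qed
  with r show thesis by (rule that)
qed

text \<open>By \<open>automorphism_chord\<close>, \<open>\<phi> j x\<close> is the midpoint of a
  chord of \<open>D\<close> along the displacement to \<open>\<phi> j (x + w)\<close>, with
  half-length up to half of that displacement. Near \<open>p\<close> such chords shrink by
  \<open>two_sided_bound\<close>, because \<open>\<sigma> (\<phi> j x)\<close> tends to 0.\<close>

lemma orbit_tendsto_local:
  assumes dom: "domain D" and aut: "\<And>j. projective_automorphism D (\<phi> j)"
    and x: "(\<lambda>j. \<phi> j x) \<longlonglongrightarrow> p"
    and seg: "closed_segment (x - 2 *\<^sub>R w) (x + 2 *\<^sub>R w) \<subseteq> D"
  shows "(\<lambda>j. \<phi> j (x + w)) \<longlonglongrightarrow> p"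
proof -
  obtain r where r: "r > 0" "r \<le> r0" and
    *: "\<And>x h. \<lbrakk>x \<in> ball p r; x + h \<in> ball p r; x - h \<in> ball p r; x + h \<in> D; x - h \<in> D\<rbrakk> \<Longrightarrow>
      c * (norm h)\<^sup>2 < - 2 * \<sigma> x"
    using two_sided_bound by blast
  have "(\<lambda>j. \<phi> j (x + w) - \<phi> j x) \<longlonglongrightarrow> 0"
  proof (rule tendstoI)
    fix e :: real assume e: "e > 0"
    define \<eta> where "\<eta> = min e r / 2"
    have \<eta>: "\<eta> > 0" "2 * \<eta> \<le> e" "\<eta> \<le> r / 2" using e r by (auto simp: \<eta>_def)
    have "(\<lambda>j. - 2 * \<sigma> (\<phi> j x)) \<longlonglongrightarrow> - 2 * \<sigma> p"
      by (intro tendsto_intros isCont_tendsto_compose[OF \<sigma>_isCont] x)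
    then have "eventually (\<lambda>j. - 2 * \<sigma> (\<phi> j x) < c * \<eta>\<^sup>2) sequentially"
      using \<sigma>_p c \<eta> by (auto intro: order_tendstoD)
    moreover have "eventually (\<lambda>j. dist (\<phi> j x) p < r / 2) sequentially"
      using x r by (intro tendstoD) auto
    ultimately show "eventually (\<lambda>j. dist (\<phi> j (x + w) - \<phi> j x) 0 < e) sequentially"
    proof eventually_elim
      case (elim j)
      define d where "d = \<phi> j (x + w) - \<phi> j x"
      have "norm d < 2 * \<eta>"
      proof (rule ccontr)
        assume "\<not> norm d < 2 * \<eta>"
        then have d: "2 * \<eta> \<le> norm d" by simp
        \<comment> \<open>The half-chord gets length exactly \<eta>, short enough to stay in the
          ball; the assumed size of \<open>d\<close> gives \<open>s \<le> 1/2\<close>, as the chord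
          lemma requires.\<close>
        define s where "s = \<eta> / norm d"
        have "norm d > 0" using d \<eta> by linarith
        then have s: "0 \<le> s" "s \<le> 1/2" using d \<eta> by (simp_all add: s_def field_simps)
        have sd: "norm (s *\<^sub>R d) = \<eta>" using d \<eta> by (auto simp: s_def)
        have "\<phi> j x \<in> ball p r" using elim r by (simp add: dist_commute)
        moreover have "\<phi> j x + s *\<^sub>R d \<in> ball p r" "\<phi> j x - s *\<^sub>R d \<in> ball p r"
          using elim(2) sd \<eta> by (auto intro!: add_in_ball simp del: mem_ball)
        moreover have "\<phi> j x + s *\<^sub>R d \<in> D" "\<phi> j x - s *\<^sub>R d \<in> D"
          using automorphism_chord[OF dom aut seg s] by (auto simp: d_def)
        ultimately have "c * \<eta>\<^sup>2 < - 2 * \<sigma> (\<phi> j x)" using * sd by metis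
        then show False using elim by simp
      qed
      then show ?case using \<eta> by (simp add: d_def)
    qed
  qed
  from tendsto_add[OF this x] show ?thesis by simp
qed

text \<open>Convergence to \<open>p\<close> passes between any two points of a small ball around
  each point of \<open>D\<close>, hence to all of the connected set \<open>D\<close>.\<close>

lemma orbit_tendsto:
  assumes dom: "domain D" and aut: "\<And>j. projective_automorphism D (\<phi> j)"
    and q: "q \<in> D" "(\<lambda>j. \<phi> j q) \<longlonglongrightarrow> p" and x: "x \<in> D"
  shows "(\<lambda>j. \<phi> j x) \<longlonglongrightarrow> p"
proof -
  have "connected D" using dom by (simp add: domain_def)
  then show ?thesis
  proof (rule connected_induction_simple[of D q x "\<lambda>x. (\<lambda>j. \<phi> j x) \<longlonglongrightarrow> p"])
    fix a assume "a \<in> D"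
    then obtain r where r: "r > 0" "ball a r \<subseteq> D" using open_D openE by blast
    \<comment> \<open>Radius \<open>r/5\<close> suffices: \<open>2 *\<^sub>R w\<close> is shorter
      than \<open>4 * r / 5\<close>, so both ends of the required segment stay in
      \<open>ball a r\<close>.\<close>
    have step: "(\<lambda>j. \<phi> j z) \<longlonglongrightarrow> p"
      if y: "y \<in> ball a (r/5)" and z: "z \<in> ball a (r/5)" and lim: "(\<lambda>j. \<phi> j y) \<longlonglongrightarrow> p" for y z
    proof -
      define w where "w = z - y"
      have w: "norm w < 2 * r / 5"
        using y z dist_triangle3[of z y a] by (simp add: w_def dist_norm norm_minus_commute)
      have "dist y a < r / 5" using y by (simp add: dist_commute)
      then have "y - 2 *\<^sub>R w \<in> ball a r" "y + 2 *\<^sub>R w \<in> ball a r"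
        using w by (auto intro!: add_in_ball simp del: mem_ball)
      then have "closed_segment (y - 2 *\<^sub>R w) (y + 2 *\<^sub>R w) \<subseteq> D"
        using closed_segment_subset[OF _ _ convex_ball] r by blast
      from orbit_tendsto_local[OF dom aut lim this] show ?thesis by (simp add: w_def)
    qed
    have "ball a (r/5) \<subseteq> D" using r by (auto simp: subset_iff)
    then have "openin (top_of_set D) (ball a (r/5))" by (rule open_subset) simp
    moreover have "a \<in> ball a (r/5)" using r by simp
    ultimately show "\<exists>T. openin (top_of_set D) T \<and> a \<in> T \<and>
        (\<forall>x\<in>T. \<forall>y\<in>T. (\<lambda>j. \<phi> j x) \<longlonglongrightarrow> p \<longrightarrow> (\<lambda>j. \<phi> j y) \<longlonglongrightarrow> p)"
      using step by blast
  qed (use q x in auto)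
qed

text \<open>Some \<open>\<phi> j\<close> carries two given points into the convex piece of
  \<open>D\<close> near \<open>p\<close>, and the segment between the images is pulled back.\<close>

lemma convex_D:
  assumes dom: "domain D" and aut: "\<And>j. projective_automorphism D (\<phi> j)"
    and q: "q \<in> D" "(\<lambda>j. \<phi> j q) \<longlonglongrightarrow> p"
  shows "convex D"
  unfolding convex_contains_segment
proof (intro ballI)
  fix x y assume x: "x \<in> D" and y: "y \<in> D"
  obtain r where r: "r > 0" "convex (D \<inter> ball p r)" using local_convex by blast
  have "eventually (\<lambda>j. dist (\<phi> j x) p < r \<and> dist (\<phi> j y) p < r) sequentially"
    using orbit_tendsto[OF dom aut q] x y r by (intro eventually_conj tendstoD) auto
  then obtain j where j: "dist (\<phi> j x) p < r" "dist (\<phi> j y) p < r"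
    using eventually_happens by force
  have "\<phi> j x \<in> D" "\<phi> j y \<in> D"
    using aut[of j] x y by (auto simp: projective_automorphism_def bij_betw_def)
  then have "closed_segment (\<phi> j x) (\<phi> j y) \<subseteq> D"
    using closed_segment_subset[OF _ _ r(2)] j by (auto simp: dist_commute)
  then show "closed_segment x y \<subseteq> D"
    by (rule automorphism_segment_pullback[OF dom aut x y])
qed

text \<open>For \<open>x\<close> near \<open>a\<close> the Taylor estimate suffices even without the
  \<open>K\<close> term. For distant \<open>x\<close>, convexity permits sliding towards
  \<open>a\<close>, which makes \<open>- G a \<bullet> (x - a)\<close> at least a fixed multiple of
  the distance; its square, times \<open>K\<close>, then dominates \<open>Q\<close>. The result is
  one quadric at \<open>a\<close> enclosing all of \<open>D\<close>.\<close>

lemma outer_bound: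
  assumes conv: "convex D" and \<epsilon>: "0 < \<epsilon>" "\<epsilon> < 1"
  obtains r K where "r > 0" "K \<ge> 0" "\<And>a x. \<lbrakk>a \<in> frontier D; a \<in> ball p r; x \<in> D\<rbrakk> \<Longrightarrow>
    0 < - G a \<bullet> (x - a) \<and> (1 - \<epsilon>) * Q (x - a) < (- G a \<bullet> (x - a)) * (1 + K * (- G a \<bullet> (x - a)))"
proof -
  obtain r where r: "r > 0" "r \<le> r0" and *: "\<And>x h. x \<in> ball p r \<Longrightarrow> x + h \<in> ball p r \<Longrightarrow>
    \<bar>\<sigma> (x + h) - \<sigma> x - G x \<bullet> h - Q h\<bar> \<le> \<epsilon> * Q h"
    using taylor_Q[OF \<epsilon>(1)] by blast
  define \<kappa> where "\<kappa> = (1 - \<epsilon>) * c * (r / 4)"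
  have \<kappa>: "\<kappa> > 0" using \<epsilon> c r by (simp add: \<kappa>_def)
  define K where "K = \<bar>C\<bar> / \<kappa>\<^sup>2"
  have K: "K \<ge> 0" by (simp add: K_def)
  have main: "0 < - G a \<bullet> (x - a) \<and> (1 - \<epsilon>) * Q (x - a) < (- G a \<bullet> (x - a)) * (1 + K * (- G a \<bullet> (x - a)))"
    if a: "a \<in> frontier D" "a \<in> ball p (r/2)" and x: "x \<in> D" for a x
  proof -
    define h where "h = x - a"
    define X where "X = - G a \<bullet> h"
    have nh: "norm h > 0" using frontier_notin[OF a(1)] x by (auto simp: h_def)
    have \<sigma>a: "\<sigma> a = 0" using \<sigma>_frontier[OF a(1)] a(2) r by auto
    have near: "(1 - \<epsilon>) * Q k < - G a \<bullet> k" if k: "a + k \<in> D" "norm k < r / 2" for k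
    proof -
      have "a + k \<in> ball p r" "a \<in> ball p r"
        using a(2) k(2) r add_in_ball[of a p k r] by (auto simp: dist_commute)
      moreover have "\<sigma> (a + k) < 0" using D_iff k(1) calculation(1) r by auto
      ultimately show ?thesis using *[of a k] \<sigma>a by (simp add: algebra_simps)
    qed
    have KX: "K * X\<^sup>2 \<ge> 0" using K by simp
    have "X > 0 \<and> (1 - \<epsilon>) * Q h < X + K * X\<^sup>2"
    proof (cases "norm h < r / 2")
      case True
      have "(1 - \<epsilon>) * Q h < X" using near[of h] True x by (simp add: h_def X_def)
      moreover have "(1 - \<epsilon>) * Q h \<ge> 0" using \<epsilon> Q_nonneg by simp
      ultimately show ?thesis using KX by linarith
    next
      case False
      \<comment> \<open>The vector is shortened to length \<open>r / 4\<close>, where the near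
        estimate applies; cancelling a factor \<open>s\<close> leaves a linear lower bound for
        \<open>X\<close>.\<close>
      define s where "s = r / 4 / norm h"
      have s: "0 < s" "s < 1" using False r nh by (auto simp: s_def field_simps)
      have "a + s *\<^sub>R h \<in> D"
      proof -
        have "open_segment x a \<subseteq> D"
          using in_interior_closure_convex_segment[OF conv, of x a] x a open_D
          by (auto simp: interior_open frontier_def)
        moreover have "a + s *\<^sub>R h \<in> open_segment x a"
          using s nh by (auto simp: in_segment h_def algebra_simps intro!: exI[of _ "1 - s"])
        ultimately show ?thesis by blast
      qed
      moreover have "norm (s *\<^sub>R h) < r / 2" using nh r by (auto simp: s_def)
      ultimately have "(1 - \<epsilon>) * Q (s *\<^sub>R h) < - G a \<bullet> (s *\<^sub>R h)" by (rule near)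
      then have "s * ((1 - \<epsilon>) * s * Q h) < s * X"
        by (simp add: Q_scale X_def power2_eq_square algebra_simps)
      then have "(1 - \<epsilon>) * s * Q h < X" using s by simp
      moreover have "(1 - \<epsilon>) * s * (c * (norm h)\<^sup>2) \<le> (1 - \<epsilon>) * s * Q h"
        using \<epsilon> s Q_lower by (intro mult_left_mono) auto
      moreover have "(1 - \<epsilon>) * s * (c * (norm h)\<^sup>2) = \<kappa> * norm h"
        using nh by (simp add: s_def \<kappa>_def power2_eq_square)
      ultimately have X: "\<kappa> * norm h < X" by linarith
      have Xpos: "X > 0" using X \<kappa> nh by (meson less_trans mult_pos_pos)
      have "(\<kappa> * norm h)\<^sup>2 \<le> X\<^sup>2" using X \<kappa> by (intro power_mono) auto
      then have "K * (\<kappa> * norm h)\<^sup>2 \<le> K * X\<^sup>2" using K by (rule mult_left_mono)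
      moreover have "K * (\<kappa> * norm h)\<^sup>2 = \<bar>C\<bar> * (norm h)\<^sup>2" using \<kappa> by (simp add: K_def power_mult_distrib)
      moreover have "C * (norm h)\<^sup>2 \<le> \<bar>C\<bar> * (norm h)\<^sup>2" by (intro mult_right_mono) auto
      ultimately have "Q h \<le> K * X\<^sup>2" using Q_upper[of h] by linarith
      moreover have "(1 - \<epsilon>) * Q h \<le> Q h" using \<epsilon> Q_nonneg[of h] by (simp add: mult_left_le_one_le)
      ultimately show ?thesis using Xpos by linarith
    qed
    then show ?thesis by (simp add: X_def h_def power2_eq_square algebra_simps)
  qed
  show thesis using r by (intro that[of "r/2" K] K main) auto
qed

text \<open>On a line in \<open>D\<close> the affine function \<open>- G p \<bullet> (x - p)\<close>
  is positive throughout, hence constant. The outer bound at \<open>p\<close> then bounds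
  \<open>Q\<close> along the line, so the line is a point.\<close>

lemma no_line:
  assumes conv: "convex D" and line: "\<And>s. q + s *\<^sub>R v \<in> D"
  shows "v = 0"
proof -
  obtain r K where r: "r > 0" and K: "K \<ge> 0" and *: "\<And>a x. \<lbrakk>a \<in> frontier D; a \<in> ball p r; x \<in> D\<rbrakk> \<Longrightarrow>
    0 < - G a \<bullet> (x - a) \<and> (1 - 1/2) * Q (x - a) < (- G a \<bullet> (x - a)) * (1 + K * (- G a \<bullet> (x - a)))"
    using outer_bound[OF conv, of "1/2"] by auto
  define X where "X = - G p \<bullet> (q - p)"
  define k where "k = - G p \<bullet> v"
  have X: "- G p \<bullet> (q + s *\<^sub>R v - p) = X + s * k" for s
    by (simp add: X_def k_def algebra_simps inner_add_right inner_diff_right)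
  have pos: "0 < X + s * k" "(1 / 2) * Q (q + s *\<^sub>R v - p) < (X + s * k) * (1 + K * (X + s * k))" for s
    using *[OF p_frontier _ line[of s]] r unfolding X by auto
  have "k = 0"
  proof (rule ccontr)
    assume "k \<noteq> 0"
    then show False using pos(1)[of "- X / k"] by simp
  qed
  define B where "B = X * (1 + K * X)"
  have bound: "c * (norm (q + s *\<^sub>R v - p))\<^sup>2 < 2 * B" for s
    using pos(2)[of s] Q_lower[of "q + s *\<^sub>R v - p"] \<open>k = 0\<close> by (simp add: B_def)
  show "v = 0"
  proof (rule ccontr)
    assume "v \<noteq> 0"
    have "0 \<le> c * (norm (q + 0 *\<^sub>R v - p))\<^sup>2" using c by simp
    then have B: "B > 0" using bound[of 0] by linarith
    define L where "L = sqrt (2 * B / c)"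
    \<comment> \<open>At this parameter the line is at distance at least \<open>L\<close> from
      \<open>p\<close>, and \<open>c * L\<^sup>2 = 2 * B\<close> contradicts
      \<open>bound\<close>.\<close>
    define s where "s = (L + norm (q - p)) / norm v"
    have "norm (s *\<^sub>R v) = L + norm (q - p)" using \<open>v \<noteq> 0\<close> B c by (simp add: s_def L_def)
    moreover have "norm (s *\<^sub>R v) \<le> norm (q + s *\<^sub>R v - p) + norm (q - p)"
      using norm_triangle_ineq4[of "q + s *\<^sub>R v - p" "q - p"] by (simp add: algebra_simps)
    ultimately have "L \<le> norm (q + s *\<^sub>R v - p)" by linarith
    then have "L\<^sup>2 \<le> (norm (q + s *\<^sub>R v - p))\<^sup>2" using B c by (intro power_mono) (auto simp: L_def)
    then have "c * L\<^sup>2 \<le> c * (norm (q + s *\<^sub>R v - p))\<^sup>2" using c by (intro mult_left_mono) auto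
    moreover have "c * L\<^sup>2 = 2 * B" using B c by (simp add: L_def)
    ultimately show False using bound[of s] by linarith
  qed
qed

text \<open>Near \<open>p\<close>, a step along \<open>G p\<close> raises \<sigma> by at least the
  gradient term, since with error factor 1 the quadratic part cannot be negative. Starting close to
  \<open>p\<close>, where \<sigma> is almost 0, such a step soon leaves \<open>D\<close>. This
  supplies the frontier point at which a quadric is attached to an orbit point.\<close>

lemma exit_point:
  assumes \<eta>: "\<eta> > 0"
  obtains \<delta> where "\<delta> > 0" "\<And>x. \<lbrakk>x \<in> D; dist x p < \<delta>\<rbrakk> \<Longrightarrow>
    \<exists>s>0. s < \<eta> \<and> x + s *\<^sub>R G p \<in> frontier D \<and> dist (x + s *\<^sub>R G p) p < \<eta>"
proof -
  obtain r where r: "r > 0" "r \<le> r0" and *: "\<And>x h. x \<in> ball p r \<Longrightarrow> x + h \<in> ball p r \<Longrightarrow>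
    \<bar>\<sigma> (x + h) - \<sigma> x - G x \<bullet> h - Q h\<bar> \<le> 1 * Q h"
    using taylor_Q[of 1] by auto
  define N where "N = norm (G p)"
  have N: "N > 0" using G_p by (simp add: N_def)
  \<comment> \<open>The second bound keeps the displacement within half of
    \<open>min r \<eta>\<close>; the other half is left for the distance from \<open>x\<close> to
    \<open>p\<close>.\<close>
  define s0 where "s0 = min (\<eta> / 2) (min r \<eta> / (2 * N))"
  have s0: "s0 > 0" "s0 < \<eta>" "s0 * N \<le> min r \<eta> / 2"
  proof -
    show "s0 > 0" "s0 < \<eta>" using \<eta> r N by (auto simp: s0_def)
    have "s0 * N \<le> min r \<eta> / (2 * N) * N" using N by (intro mult_right_mono) (auto simp: s0_def)
    then show "s0 * N \<le> min r \<eta> / 2" using N by simp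
  qed
  have "(G \<longlongrightarrow> G p) (nhds p)"
    using G_cont unfolding isCont_def tendsto_at_iff_tendsto_nhds .
  then have "((\<lambda>x. G x \<bullet> G p) \<longlongrightarrow> G p \<bullet> G p) (nhds p)"
    by (intro tendsto_intros)
  moreover have "G p \<bullet> G p > N\<^sup>2 / 2" using N by (simp add: N_def dot_square_norm)
  ultimately have "eventually (\<lambda>x. G x \<bullet> G p > N\<^sup>2 / 2) (nhds p)" by (rule order_tendstoD)
  moreover have "(\<sigma> \<longlongrightarrow> 0) (nhds p)"
    using \<sigma>_isCont unfolding isCont_def tendsto_at_iff_tendsto_nhds by (simp add: \<sigma>_p)
  then have "eventually (\<lambda>x. \<sigma> x > - (s0 * (N\<^sup>2 / 2))) (nhds p)"
    using s0 N by (auto intro: order_tendstoD)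
  ultimately have "eventually (\<lambda>x. G x \<bullet> G p > N\<^sup>2 / 2 \<and> \<sigma> x > - (s0 * (N\<^sup>2 / 2))) (nhds p)"
    by (rule eventually_conj)
  then obtain \<delta>' where \<delta>': "\<delta>' > 0"
    "\<And>x. dist x p < \<delta>' \<Longrightarrow> G x \<bullet> G p > N\<^sup>2 / 2 \<and> \<sigma> x > - (s0 * (N\<^sup>2 / 2))"
    unfolding eventually_nhds_metric by blast
  define \<delta> where "\<delta> = min \<delta>' (min r \<eta> / 2)"
  have "\<exists>s>0. s < \<eta> \<and> x + s *\<^sub>R G p \<in> frontier D \<and> dist (x + s *\<^sub>R G p) p < \<eta>"
    if x: "x \<in> D" "dist x p < \<delta>" for x
  proof -
    have near: "dist (x + s *\<^sub>R G p) p < min r \<eta>" if "0 \<le> s" "s \<le> s0" for s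
    proof -
      have "norm (x + s *\<^sub>R G p - p) \<le> norm (x - p) + norm (s *\<^sub>R G p)"
        using norm_triangle_ineq[of "x - p" "s *\<^sub>R G p"] by (simp add: algebra_simps)
      moreover have "norm (s *\<^sub>R G p) \<le> s0 * N"
        using that N by (auto simp: N_def intro!: mult_right_mono)
      moreover have "norm (x - p) < min r \<eta> / 2" using x by (simp add: \<delta>_def dist_norm)
      ultimately show ?thesis using s0(3) by (simp add: dist_norm)
    qed
    have "x + s0 *\<^sub>R G p \<in> ball p r" "x \<in> ball p r"
      using near[of s0] near[of 0] s0 by (auto simp: dist_commute)
    from *[OF this(2,1)] have "\<sigma> (x + s0 *\<^sub>R G p) \<ge> \<sigma> x + s0 * (G x \<bullet> G p)"
      by (simp add: abs_le_iff)
    moreover have "s0 * (N\<^sup>2 / 2) < s0 * (G x \<bullet> G p)" "\<sigma> x > - (s0 * (N\<^sup>2 / 2))"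
      using \<delta>'(2)[of x] x s0 by (auto simp: \<delta>_def)
    ultimately have "\<sigma> (x + s0 *\<^sub>R G p) > 0" by linarith
    then have "x + s0 *\<^sub>R G p \<notin> D"
      using D_iff[of "x + s0 *\<^sub>R G p"] \<open>x + s0 *\<^sub>R G p \<in> ball p r\<close> r by auto
    then have "closed_segment x (x + s0 *\<^sub>R G p) \<inter> frontier D \<noteq> {}"
      using x by (intro connected_Int_frontier) auto
    then obtain u where u: "0 \<le> u" "u \<le> 1" "x + (u * s0) *\<^sub>R G p \<in> frontier D"
      by (auto simp: in_segment algebra_simps)
    have "u \<noteq> 0" using u x frontier_notin by auto
    moreover have "u * s0 \<le> s0" using u s0 by (simp add: mult_left_le_one_le)
    moreover from this have "u * s0 < \<eta>" using s0 by linarith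
    ultimately show ?thesis
      using u s0 near[of "u * s0"] by (intro exI[of _ "u * s0"]) auto
  qed
  moreover have "\<delta> > 0" using \<delta>' r \<eta> by (simp add: \<delta>_def)
  ultimately show thesis by (rule that[rotated])
qed

end

section \<open>Pulled back Lorentz cones\<close>

text \<open>A quadratic form with value 1 at \<open>(1, 0)\<close>, the square being completed in
  the first coordinate; for positive definite \<open>B\<close> it has Lorentz signature.\<close>

definition lorentz :: "real^'n \<Rightarrow> real^'n^'n \<Rightarrow> real \<times> (real^'n) \<Rightarrow> real" where
  "lorentz \<beta> B z = (fst z + \<beta> \<bullet> snd z)\<^sup>2 - snd z \<bullet> (B *v snd z)"

definition nappe :: "real^'n \<Rightarrow> real^'n^'n \<Rightarrow> (real \<times> (real^'n)) set" where
  "nappe \<beta> B = {z. 0 < fst z + \<beta> \<bullet> snd z \<and> 0 < lorentz \<beta> B z}"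

lemma linear_functional_inner:
  fixes f :: "real^'n \<Rightarrow> real"
  assumes "linear f"
  shows "(\<chi> i. f (axis i 1)) \<bullet> v = f v"
proof -
  have "f v = f (\<Sum>i\<in>UNIV. (v $ i) *\<^sub>R axis i 1)"
    by (metis basis_expansion scalar_mult_eq_scaleR)
  also have "\<dots> = (\<Sum>i\<in>UNIV. v $ i * f (axis i 1))"
    using assms by (simp add: linear_sum linear_scale)
  finally show ?thesis by (simp add: inner_vec_def mult.commute)
qed

text \<open>Completing the square after symmetrisation: \<beta> is the polar form against
  \<open>(1, 0)\<close>, and \<open>B\<close> is the square of \<beta> minus the form on the vectors
  \<open>(0, v)\<close>.\<close>

lemma quadratic_form_lorentz:
  fixes b :: "real \<times> (real^'n) \<Rightarrow> real \<times> (real^'n) \<Rightarrow> real"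
  assumes b: "bilinear b" and b1: "b (1, 0) (1, 0) = 1"
  obtains \<beta> B where "\<And>z. lorentz \<beta> B z = b z z" "\<And>v w. v \<bullet> (B *v w) = w \<bullet> (B *v v)"
proof -
  define s where "s z w = (b z w + b w z) / 2" for z w
  have sym: "s z w = s w z" for z w by (simp add: s_def add.commute)
  have add: "s z (w + w') = s z w + s z w'" and scale: "s z (k *\<^sub>R w) = k * s z w" for z w w' k
    using b by (simp_all add: s_def bilinear_ladd bilinear_radd bilinear_lmul bilinear_rmul field_simps)
  define \<beta> where "\<beta> = (\<chi> i. s (1, 0) (0, axis i 1))"
  have lin: "linear (\<lambda>v. s z (0, v))" for z
  proof (rule linearI)
    show "s z (0, x + y) = s z (0, x) + s z (0, y)" for x y
      using add[of z "(0, x)" "(0, y)"] by simp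
    show "s z (0, k *\<^sub>R x) = k *\<^sub>R s z (0, x)" for k x
      using scale[of z k "(0, x)"] by simp
  qed
  have \<beta>: "\<beta> \<bullet> v = s (1, 0) (0, v)" for v
    unfolding \<beta>_def by (rule linear_functional_inner[OF lin])
  define g where "g v w = (\<beta> \<bullet> v) * (\<beta> \<bullet> w) - s (0, v) (0, w)" for v w
  have g_sym: "g v w = g w v" for v w by (simp add: g_def sym mult.commute)
  have g_lin: "linear (g v)" for v
    unfolding g_def
    by (intro linearI) (auto simp: linear_add[OF lin] linear_scale[OF lin] algebra_simps inner_add_right)
  define B where "B = (\<chi> i j. g (axis i 1) (axis j 1))"
  have "(B *v w) $ i = g (axis i 1) w" for w i
    using linear_functional_inner[OF g_lin, of "axis i 1" w]
    by (simp add: B_def matrix_vector_mul_component)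
  then have "B *v w = (\<chi> i. g w (axis i 1))" for w
    by (simp add: vec_eq_iff g_sym)
  then have B: "v \<bullet> (B *v w) = g w v" for v w
    using linear_functional_inner[OF g_lin] by (simp add: inner_commute)
  have "lorentz \<beta> B z = b z z" for z
  proof -
    obtain t v where z: "z = (t, v)" by force
    have s_bb: "s z z = b z z" "s (1, 0) (1, 0) = 1" using b1 by (simp_all add: s_def)
    have z': "z = t *\<^sub>R (1, 0) + (0, v)" by (simp add: z)
    have "s z z = t * s z (1, 0) + s z (0, v)"
      by (subst (2) z') (simp add: add scale del: scaleR_Pair add_Pair)
    also have "s z (1, 0) = t * s (1, 0) (1, 0) + s (1, 0) (0, v)"
      by (subst sym, subst z') (simp add: add scale del: scaleR_Pair add_Pair)
    also have "s z (0, v) = t * s (1, 0) (0, v) + s (0, v) (0, v)"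
      by (subst sym, subst z') (simp add: add scale sym[of "(0, v)" "(1, 0)"] del: scaleR_Pair add_Pair)
    finally show ?thesis
      using s_bb by (simp add: lorentz_def z B g_def \<beta> power2_eq_square algebra_simps)
  qed
  moreover have "v \<bullet> (B *v w) = w \<bullet> (B *v v)" for v w by (simp add: B g_sym)
  ultimately show thesis by (rule that)
qed

lemma affine_pos:
  fixes a b :: real
  assumes "0 < a" and "\<And>\<theta>. 0 \<le> \<theta> \<Longrightarrow> \<theta> \<le> 1 \<Longrightarrow> (1 - \<theta>) * a + \<theta> * b \<noteq> 0"
  shows "0 < b"
proof (rule ccontr)
  assume "\<not> 0 < b"
  then have "a - b > 0" "0 \<le> a / (a - b)" "a / (a - b) \<le> 1"
    using assms(1) by (auto simp: divide_le_eq)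
  moreover from this have "(1 - a / (a - b)) * a + a / (a - b) * b = 0"
    by (simp add: field_simps)
  ultimately show False using assms(2)[of "a / (a - b)"] by simp
qed

text \<open>In the application \<open>X\<close>, \<open>T\<close>, \<open>S\<close> are values at a point of the cone, \<open>\<delta>\<close>,
  \<open>1 + K * \<delta>\<close> the values of \<open>X\<close>, \<open>T\<close> at the base point; the outer form is
  \<open>X * T - (1 - \<epsilon>') * S\<close>, and the conclusion is positivity of the inner form.\<close>

lemma sandwich_arith:
  fixes \<epsilon> \<delta> K X T S \<mu> :: real
  assumes \<epsilon>: "0 < \<epsilon>" "\<epsilon> < 1" and \<delta>: "0 < \<delta>" and K: "0 \<le> K" "K * \<delta> \<le> \<epsilon>^3 / 8"
    and X: "0 < X" "\<epsilon> * X < \<delta>" and T: "\<epsilon> * (1 + K * \<delta>) < T" "\<epsilon> * T < 1 + K * \<delta>"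
    and \<mu>: "\<delta> / 2 \<le> \<mu>" and S: "0 \<le> S" "\<epsilon> * \<mu> \<le> X * T - (1 - \<epsilon>^3 / 64) * S"
  shows "\<epsilon> / 2 \<le> T - K * X" "S \<le> 4 * \<delta> / \<epsilon>\<^sup>2" "(1 + \<epsilon>^3 / 64) * S < X * (T - K * X)"
proof -
  have e3: "\<epsilon>^3 \<le> 1" using \<epsilon> by (simp add: power_le_one)
  have e2: "\<epsilon>\<^sup>2 \<le> \<epsilon>" using \<epsilon> by (simp add: power2_eq_square mult_left_le)
  have X': "X \<le> \<delta> / \<epsilon>" using X \<epsilon> by (simp add: field_simps)
  have T': "T \<le> 2 / \<epsilon>"
  proof -
    have "\<epsilon> * T \<le> 2" using T(2) K(2) e3 by linarith
    then show ?thesis using \<epsilon> by (simp add: field_simps)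
  qed
  have T0: "0 < T"
  proof -
    have "0 \<le> \<epsilon> * (1 + K * \<delta>)" using \<epsilon> K \<delta> by simp
    then show ?thesis using T(1) by linarith
  qed
  have KX: "K * X \<le> \<epsilon>\<^sup>2 / 8"
  proof -
    have "K * X \<le> K * (\<delta> / \<epsilon>)" using X' K(1) by (rule mult_left_mono)
    also have "\<dots> = (K * \<delta>) / \<epsilon>" by simp
    also have "\<dots> \<le> (\<epsilon>^3 / 8) / \<epsilon>" using K(2) \<epsilon> by (intro divide_right_mono) auto
    also have "\<dots> = \<epsilon>\<^sup>2 / 8" using \<epsilon> by (simp add: power2_eq_square power3_eq_cube)
    finally show ?thesis .
  qed
  have "\<epsilon> \<le> \<epsilon> * (1 + K * \<delta>)" using \<epsilon> K \<delta> by simp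
  then show "\<epsilon> / 2 \<le> T - K * X" using T(1) KX e2 \<epsilon> by linarith
  have "X * T \<le> (\<delta> / \<epsilon>) * (2 / \<epsilon>)" using X' T' X T0 \<delta> \<epsilon> by (intro mult_mono) auto
  then have XT: "X * T \<le> 2 * \<delta> / \<epsilon>\<^sup>2" by (simp add: power2_eq_square mult.commute)
  have \<epsilon>\<mu>: "\<epsilon> * \<delta> / 2 \<le> \<epsilon> * \<mu>" using mult_left_mono[OF \<mu>, of \<epsilon>] \<epsilon> by simp
  have "\<epsilon> * \<delta> > 0" using \<epsilon> \<delta> by simp
  have "\<epsilon>^3 / 64 * S \<le> 1 / 2 * S" using e3 S by (intro mult_right_mono) auto
  then have "S / 2 \<le> (1 - \<epsilon>^3 / 64) * S" by (simp add: left_diff_distrib)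
  then show S': "S \<le> 4 * \<delta> / \<epsilon>\<^sup>2" using S(2) XT \<epsilon>\<mu> \<open>\<epsilon> * \<delta> > 0\<close> by linarith
  have "\<epsilon>^3 / 64 * S \<le> \<epsilon>^3 / 64 * (4 * \<delta> / \<epsilon>\<^sup>2)" using S' \<epsilon> by (intro mult_left_mono) auto
  also have "\<dots> = \<epsilon> * \<delta> / 16" using \<epsilon> by (simp add: power2_eq_square power3_eq_cube)
  finally have S'': "\<epsilon>^3 / 64 * S \<le> \<epsilon> * \<delta> / 16" .
  have "X * (K * X) \<le> (\<delta> / \<epsilon>) * (\<epsilon>\<^sup>2 / 8)" using X' KX X K \<delta> \<epsilon> by (intro mult_mono) auto
  also have "\<dots> = \<epsilon> * \<delta> / 8" using \<epsilon> by (simp add: power2_eq_square)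
  finally have KX2: "X * (K * X) \<le> \<epsilon> * \<delta> / 8" .
  \<comment> \<open>The inner form is the outer one minus twice \<open>\<epsilon>^3 / 64 * S\<close>
    and minus \<open>X * (K * X)\<close>. These two losses are at most
    \<open>\<epsilon> * \<delta> / 8\<close> each, whereas the outer form is at least
    \<open>\<epsilon> * \<delta> / 2\<close>.\<close>
  show "(1 + \<epsilon>^3 / 64) * S < X * (T - K * X)"
    using S(2) S'' KX2 \<epsilon>\<mu> \<open>\<epsilon> * \<delta> > 0\<close> by (simp add: algebra_simps)
qed

section \<open>Inner and outer quadrics pulled back to the base point\<close>

context osculated_boundary
begin

text \<open>The form is the outer quadric at a frontier point close to some
  \<open>\<phi> j q\<close>, pulled back by the lift of \<open>\<phi> j\<close> and normalised at
  \<open>(1, 0)\<close>. The last property concerns vectors well inside its cone and comparable to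
  \<open>(1, 0)\<close>: at their images the inner quadric, which lies in \<open>D\<close> by the
  Taylor estimate, is hardly smaller than the outer one. As \<epsilon> tends to 0 its three
  conditions relax to membership in the nappe.\<close>

lemma sandwich:
  assumes dom: "domain D" and aut: "\<And>j. projective_automorphism D (\<phi> j)"
    and q: "q \<in> D" "(\<lambda>j. \<phi> j q) \<longlonglongrightarrow> p" and \<epsilon>: "0 < \<epsilon>" "\<epsilon> < 1"
  obtains \<beta> :: "real^'n" and B :: "real^'n^'n"
  where "\<And>v w. v \<bullet> (B *v w) = w \<bullet> (B *v v)" "\<And>v. 0 \<le> v \<bullet> (B *v v)"
    "\<And>v. q + v \<in> D \<Longrightarrow> (1, v) \<in> nappe \<beta> B"
    "\<And>z. \<lbrakk>\<epsilon> \<le> lorentz \<beta> B z; z - \<epsilon> *\<^sub>R (1, 0) \<in> nappe \<beta> B; (1, 0) - \<epsilon> *\<^sub>R z \<in> nappe \<beta> B\<rbrakk>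
      \<Longrightarrow> z \<in> cone_at q D"
proof -
  have conv: "convex D" by (rule convex_D[OF dom aut q])
  define \<epsilon>' where "\<epsilon>' = \<epsilon>^3 / 64"
  have e3: "\<epsilon>^3 \<le> 1" using \<epsilon> by (simp add: power_le_one)
  have \<epsilon>': "0 < \<epsilon>'" "\<epsilon>' < 1" using \<epsilon> e3 by (simp_all add: \<epsilon>'_def)
  obtain r1 K where r1: "r1 > 0" and K: "K \<ge> 0" and outer: "\<And>a x. \<lbrakk>a \<in> frontier D; a \<in> ball p r1; x \<in> D\<rbrakk> \<Longrightarrow>
    0 < - G a \<bullet> (x - a) \<and> (1 - \<epsilon>') * Q (x - a) < (- G a \<bullet> (x - a)) * (1 + K * (- G a \<bullet> (x - a)))"
    using outer_bound[OF conv \<epsilon>'] by blast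
  obtain r2 where r2: "r2 > 0" "r2 \<le> r0" and tay: "\<And>x h. x \<in> ball p r2 \<Longrightarrow> x + h \<in> ball p r2 \<Longrightarrow>
    \<bar>\<sigma> (x + h) - \<sigma> x - G x \<bullet> h - Q h\<bar> \<le> \<epsilon>' * Q h"
    using taylor_Q[OF \<epsilon>'(1)] by blast
  define N where "N = norm (G p)"
  have N: "N > 0" using G_p by (simp add: N_def)
  have "(G \<longlongrightarrow> G p) (nhds p)"
    using G_cont unfolding isCont_def tendsto_at_iff_tendsto_nhds .
  then have "((\<lambda>x. G x \<bullet> G p) \<longlongrightarrow> G p \<bullet> G p) (nhds p)"
    by (intro tendsto_intros)
  moreover have "G p \<bullet> G p > N\<^sup>2 / 2" "G p \<bullet> G p < 2 * N\<^sup>2" using N by (simp_all add: N_def dot_square_norm)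
  ultimately have "eventually (\<lambda>x. G x \<bullet> G p > N\<^sup>2 / 2 \<and> G x \<bullet> G p < 2 * N\<^sup>2) (nhds p)"
    by (intro eventually_conj order_tendstoD)
  then obtain \<eta>1 where \<eta>1: "\<eta>1 > 0"
    "\<And>x. dist x p < \<eta>1 \<Longrightarrow> G x \<bullet> G p > N\<^sup>2 / 2 \<and> G x \<bullet> G p < 2 * N\<^sup>2"
    unfolding eventually_nhds_metric by blast
  \<comment> \<open>All smallness conditions on \<eta> have this form, so one \<eta> meets them
    together. They keep \<open>a\<close> in range of the estimates, make \<open>K * \<delta>\<close>
    small, secure \<open>\<delta> / 2 \<le> \<mu>\<close> and keep the later vector \<open>h\<close>
    in the Taylor ball.\<close>
  have ev: "eventually (\<lambda>\<eta>. \<eta> * A < A') (at_right 0)" if "0 < A'" for A A' :: real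
  proof -
    have "((\<lambda>\<eta>. \<eta> * A) \<longlongrightarrow> 0 * A) (at_right 0)" by (intro tendsto_intros)
    then show ?thesis using that by (auto intro: order_tendstoD)
  qed
  have "eventually (\<lambda>\<eta>::real. \<eta> > 0) (at_right 0)" by (simp add: eventually_at_right_less)
  moreover have "eventually (\<lambda>\<eta>. \<eta> * 1 < min \<eta>1 (min r1 (r2/2))) (at_right 0)"
    using \<eta>1 r1 r2 by (intro ev) auto
  moreover have "eventually (\<lambda>\<eta>. \<eta> * (K * (2 * N\<^sup>2)) < \<epsilon>^3 / 8) (at_right 0)"
    using \<epsilon> by (intro ev) auto
  moreover have "eventually (\<lambda>\<eta>. \<eta> * Q (G p) < N\<^sup>2 / 4) (at_right 0)"
    using N by (intro ev) auto
  moreover have "eventually (\<lambda>\<eta>. \<eta> * (2 * N\<^sup>2) < c * \<epsilon>^4 / 16 * (r2 / 2)\<^sup>2) (at_right 0)"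
    using c \<epsilon> r2 by (intro ev) auto
  ultimately have "eventually (\<lambda>\<eta>. \<eta> > 0 \<and> \<eta> * 1 < min \<eta>1 (min r1 (r2/2)) \<and> \<eta> * (K * (2 * N\<^sup>2)) < \<epsilon>^3 / 8
      \<and> \<eta> * Q (G p) < N\<^sup>2 / 4 \<and> \<eta> * (2 * N\<^sup>2) < c * \<epsilon>^4 / 16 * (r2 / 2)\<^sup>2) (at_right 0)"
    by (intro eventually_conj)
  then obtain \<eta> where \<eta>: "\<eta> > 0" "\<eta> < min \<eta>1 (min r1 (r2/2))" "\<eta> * (K * (2 * N\<^sup>2)) < \<epsilon>^3 / 8"
    "\<eta> * Q (G p) < N\<^sup>2 / 4" "\<eta> * (2 * N\<^sup>2) < c * \<epsilon>^4 / 16 * (r2 / 2)\<^sup>2"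
    using eventually_happens[of _ "at_right (0::real)"] trivial_limit_at_right_real by auto
  obtain \<delta>' where \<delta>': "\<delta>' > 0" "\<And>x. \<lbrakk>x \<in> D; dist x p < \<delta>'\<rbrakk> \<Longrightarrow>
    \<exists>s>0. s < \<eta> \<and> x + s *\<^sub>R G p \<in> frontier D \<and> dist (x + s *\<^sub>R G p) p < \<eta>"
    using exit_point[OF \<eta>(1)] by blast
  have "eventually (\<lambda>j. dist (\<phi> j q) p < \<delta>') sequentially"
    using q(2) \<delta>'(1) by (rule tendstoD)
  then obtain j where j: "dist (\<phi> j q) p < \<delta>'" using eventually_happens by force
  have "\<phi> j q \<in> D" using aut[of j] q(1) by (auto simp: projective_automorphism_def bij_betw_def)
  from \<delta>'(2)[OF this j] obtain s where s: "0 < s" "s < \<eta>"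
    "\<phi> j q + s *\<^sub>R G p \<in> frontier D" "dist (\<phi> j q + s *\<^sub>R G p) p < \<eta>" by blast
  define a where "a = \<phi> j q + s *\<^sub>R G p"
  have a: "a \<in> frontier D" "dist a p < \<eta>" using s by (simp_all add: a_def)
  have \<sigma>a: "\<sigma> a = 0" using a \<eta> r2 by (intro \<sigma>_frontier) (auto simp: dist_commute)
  obtain M where M: "linear M" "M (1, 0) = (1, \<phi> j q - a)" "\<And>z. M z \<in> cone_at a D \<longleftrightarrow> z \<in> cone_at q D"
    using projective_automorphism_lift_at[OF dom aut q(1)] by blast
  \<comment> \<open>Homogenised at \<open>a\<close>, the outer condition reads
    \<open>(1 - \<epsilon>') * Q (Y z) < X z * T z\<close> with linear \<open>X\<close> and
    \<open>T\<close>. The inner quadric has \<open>T z - K * X z\<close>, the first coordinate of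
    \<open>M z\<close>, in place of \<open>T z\<close>, and \<open>1 + \<epsilon>'\<close> in place
    of \<open>1 - \<epsilon>'\<close>.\<close>
  define Y where "Y z = snd (M z)" for z
  define X where "X z = - G a \<bullet> Y z" for z
  define T where "T z = fst (M z) + K * X z" for z
  have Y_lin: "linear Y"
    unfolding Y_def[abs_def]
    using linear_compose[OF M(1) linear_snd] by (simp add: o_def)
  have X_add: "X (z + w) = X z + X w" and X_scale: "X (k *\<^sub>R z) = k * X z" and X_diff: "X (z - w) = X z - X w" for z w k
    using Y_lin by (simp_all add: X_def linear_add linear_scale linear_diff inner_add_right inner_diff_right)
  have T_add: "T (z + w) = T z + T w" and T_scale: "T (k *\<^sub>R z) = k * T z" and T_diff: "T (z - w) = T z - T w" for z w k
    by (simp_all add: T_def linear_add[OF M(1)] linear_scale[OF M(1)] linear_diff[OF M(1)] X_add X_scale X_diff algebra_simps)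
  define \<delta> where "\<delta> = X (1, 0)"
  have Y1: "Y (1, 0) = - s *\<^sub>R G p" by (simp add: Y_def M(2) a_def)
  have \<delta>_eq: "\<delta> = s * (G a \<bullet> G p)" by (simp add: \<delta>_def X_def Y1)
  have T1: "T (1, 0) = 1 + K * \<delta>" by (simp add: T_def M(2) \<delta>_def)
  have Ga: "G a \<bullet> G p > N\<^sup>2 / 2" "G a \<bullet> G p < 2 * N\<^sup>2" using \<eta>1(2)[of a] a \<eta> by auto
  have \<delta>_low: "s * (N\<^sup>2 / 2) \<le> \<delta>" using Ga s by (simp add: \<delta>_eq mult_left_mono)
  have \<delta>_up: "\<delta> \<le> \<eta> * (2 * N\<^sup>2)" unfolding \<delta>_eq using Ga s \<eta> by (intro mult_mono) auto
  have \<delta>: "\<delta> > 0"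
    using N s by (intro less_le_trans[OF _ \<delta>_low]) simp
  have K\<delta>: "K * \<delta> \<le> \<epsilon>^3 / 8"
  proof -
    have "K * \<delta> \<le> K * (\<eta> * (2 * N\<^sup>2))" using \<delta>_up K by (rule mult_left_mono)
    then show ?thesis using \<eta>(3) by (simp add: mult.left_commute)
  qed
  define \<mu> where "\<mu> = X (1, 0) * T (1, 0) - (1 - \<epsilon>') * Q (Y (1, 0))"
  \<comment> \<open>The \<open>Q\<close> term is quadratic in \<open>s\<close>, while \<delta> is of
    order \<open>s\<close>; a small \<open>s\<close> costs at most half of \<delta>.\<close>
  have \<mu>: "\<delta> / 2 \<le> \<mu>"
  proof -
    have "Q (Y (1, 0)) = s * (s * Q (G p))" unfolding Y1 Q_scale by (simp add: power2_eq_square)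
    also have "\<dots> \<le> s * (\<eta> * Q (G p))"
      using s \<eta> Q_nonneg by (intro mult_left_mono mult_right_mono) auto
    also have "\<dots> \<le> s * (N\<^sup>2 / 4)" using s \<eta> by (intro mult_left_mono) auto
    also have "\<dots> \<le> \<delta> / 2" using \<delta>_low by simp
    finally have "Q (Y (1, 0)) \<le> \<delta> / 2" .
    moreover have "(1 - \<epsilon>') * Q (Y (1, 0)) \<le> Q (Y (1, 0))"
      using \<epsilon>' Q_nonneg by (simp add: mult_left_le_one_le)
    moreover have "\<delta> * (1 + K * \<delta>) \<ge> \<delta>" using \<delta> K by (simp add: distrib_left)
    ultimately show ?thesis unfolding \<mu>_def T1 \<delta>_def[symmetric] by linarith
  qed
  have \<mu>0: "\<mu> > 0" using \<mu> \<delta> by linarith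
  define b where "b z w = (X z * T w - (1 - \<epsilon>') * (Y z \<bullet> (P *v Y w))) / \<mu>" for z w
  have "bilinear b"
    unfolding bilinear_def b_def
    using Y_lin
    by (intro conjI allI linearI)
      (auto simp: X_add X_scale T_add T_scale linear_add linear_scale inner_add_left inner_add_right
        matrix_vector_right_distrib matrix_vector_mult_scaleR algebra_simps add_divide_distrib diff_divide_distrib)
  moreover have "b (1, 0) (1, 0) = 1" using \<mu>0 by (simp add: b_def \<mu>_def Q_def)
  ultimately obtain \<beta> B where B: "\<And>z. lorentz \<beta> B z = b z z" "\<And>v w. v \<bullet> (B *v w) = w \<bullet> (B *v v)"
    using quadratic_form_lorentz by blast
  have F: "lorentz \<beta> B z = (X z * T z - (1 - \<epsilon>') * Q (Y z)) / \<mu>" for z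
    by (simp add: B(1) b_def Q_def)
  have F_pos: "X z * T z > 0" if "lorentz \<beta> B z > 0" for z
  proof -
    have "X z * T z - (1 - \<epsilon>') * Q (Y z) > 0" using that \<mu>0 by (simp add: F zero_less_divide_iff)
    moreover have "(1 - \<epsilon>') * Q (Y z) \<ge> 0" using \<epsilon>' Q_nonneg by simp
    ultimately show ?thesis by linarith
  qed
  have psd: "0 \<le> v \<bullet> (B *v v)" for v
  proof -
    \<comment> \<open>This \<open>t\<close> makes \<open>X\<close> vanish at \<open>(t, v)\<close>,
      where the form cannot be positive because \<open>X * T\<close> is its only positive
      part.\<close>
    define t where "t = - X (0, v) / \<delta>"
    have "(t, v) = t *\<^sub>R (1, 0) + (0, v)" by simp
    then have "X (t, v) = t * \<delta> + X (0, v)" by (metis X_add X_scale \<delta>_def)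
    then have "X (t, v) = 0" using \<delta> by (simp add: t_def)
    then have "\<not> lorentz \<beta> B (t, v) > 0" using F_pos[of "(t, v)"] by auto
    then have "(t + \<beta> \<bullet> v)\<^sup>2 \<le> v \<bullet> (B *v v)" by (simp add: lorentz_def)
    then show ?thesis by (meson order_trans zero_le_power2)
  qed
  \<comment> \<open>The form stays positive on the segment from \<open>(1, 0)\<close> to
    \<open>w\<close>, so \<open>X * T\<close> has no zero there and both factors keep the positive
    sign they have at \<open>(1, 0)\<close>.\<close>
  have nappe_pos: "X w > 0 \<and> T w > 0" if "w \<in> nappe \<beta> B" for w
  proof -
    obtain t v where w: "w = (t, v)" by force
    define l where "l = t + \<beta> \<bullet> v"
    have l: "l > 0" "v \<bullet> (B *v v) < l\<^sup>2" using that by (simp_all add: nappe_def lorentz_def w l_def)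
    have "lorentz \<beta> B ((1 - \<theta>) *\<^sub>R (1, 0) + \<theta> *\<^sub>R w) > 0" if \<theta>: "0 \<le> \<theta>" "\<theta> \<le> 1" for \<theta>
    proof -
      have "lorentz \<beta> B ((1 - \<theta>) *\<^sub>R (1, 0) + \<theta> *\<^sub>R w) = (1 - \<theta> + \<theta> * l)\<^sup>2 - \<theta>\<^sup>2 * (v \<bullet> (B *v v))"
        by (simp add: lorentz_def w l_def matrix_vector_mult_scaleR power2_eq_square algebra_simps)
      moreover have "\<theta>\<^sup>2 * (v \<bullet> (B *v v)) < (1 - \<theta> + \<theta> * l)\<^sup>2"
      proof (cases "\<theta> = 0")
        case False
        then have "\<theta>\<^sup>2 * (v \<bullet> (B *v v)) < \<theta>\<^sup>2 * l\<^sup>2" using l by (intro mult_strict_left_mono) auto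
        also have "\<dots> = (\<theta> * l)\<^sup>2" by (simp add: power_mult_distrib)
        also have "\<dots> \<le> (1 - \<theta> + \<theta> * l)\<^sup>2" using \<theta> l by (intro power_mono) auto
        finally show ?thesis .
      qed simp
      ultimately show ?thesis by simp
    qed
    from F_pos[OF this] have "((1 - \<theta>) * \<delta> + \<theta> * X w) * ((1 - \<theta>) * (1 + K * \<delta>) + \<theta> * T w) > 0"
      if "0 \<le> \<theta>" "\<theta> \<le> 1" for \<theta>
      using that unfolding X_add T_add X_scale T_scale T1 \<delta>_def[symmetric] by blast
    then have *: "(1 - \<theta>) * \<delta> + \<theta> * X w \<noteq> 0" "(1 - \<theta>) * (1 + K * \<delta>) + \<theta> * T w \<noteq> 0"
      if "0 \<le> \<theta>" "\<theta> \<le> 1" for \<theta>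
      using that by (metis less_irrefl mult_zero_left mult_zero_right)+
    have "0 < 1 + K * \<delta>" using K \<delta> by (simp add: add_pos_nonneg)
    then show ?thesis using affine_pos[OF \<delta> *(1)] affine_pos[OF _ *(2)] by blast
  qed
  have inside: "lorentz \<beta> B (1, v) > 0" if "q + v \<in> D" for v
  proof -
    have "M (1, v) \<in> cone_at a D" using that by (simp add: M(3) cone_at_iff)
    then obtain t y where ty: "M (1, v) = (t, y)" "t > 0" "a + (1/t) *\<^sub>R y \<in> D"
      by (cases "M (1, v)") (auto simp: cone_at_iff)
    have a': "a \<in> ball p r1" using a \<eta> by (simp add: dist_commute)
    define X' where "X' = - G a \<bullet> y"
    have "(1 - \<epsilon>') * Q ((1/t) *\<^sub>R y) < (- G a \<bullet> ((1/t) *\<^sub>R y)) * (1 + K * (- G a \<bullet> ((1/t) *\<^sub>R y)))"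
      using outer[OF a(1) a' ty(3)] by simp
    then have "(1 - \<epsilon>') * (Q y / t\<^sup>2) < X' / t * (1 + K * (X' / t))"
      by (simp add: Q_scale X'_def power_divide)
    then have "(1 - \<epsilon>') * (Q y / t\<^sup>2) * t\<^sup>2 < X' / t * (1 + K * (X' / t)) * t\<^sup>2"
      using ty(2) by (intro mult_strict_right_mono) auto
    also have "(1 - \<epsilon>') * (Q y / t\<^sup>2) * t\<^sup>2 = (1 - \<epsilon>') * Q y" using ty(2) by simp
    also have "X' / t * (1 + K * (X' / t)) * t\<^sup>2 = X' * (t + K * X')"
      using ty(2) by (simp add: field_simps power2_eq_square)
    finally show ?thesis using \<mu>0 by (simp add: F X_def T_def Y_def ty(1) X'_def)
  qed
  have "(1, v) \<in> nappe \<beta> B" if v: "q + v \<in> D" for v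
  proof -
    \<comment> \<open>The segment from \<open>q\<close> to \<open>q + v\<close> lies in the convex
      set \<open>D\<close>, so the form is positive along it. As \<open>B\<close> is semidefinite,
      the linear part cannot vanish, and \<open>v\<close> stays on the side of the base
      point.\<close>
    have "(1 - \<theta>) * 1 + \<theta> * (1 + \<beta> \<bullet> v) \<noteq> 0" if \<theta>: "0 \<le> \<theta>" "\<theta> \<le> 1" for \<theta>
    proof
      assume 0: "(1 - \<theta>) * 1 + \<theta> * (1 + \<beta> \<bullet> v) = 0"
      have "q + \<theta> *\<^sub>R v \<in> D"
        using convexD_alt[OF conv q(1) v \<theta>] by (simp add: algebra_simps)
      from inside[OF this] have "(1 + \<beta> \<bullet> (\<theta> *\<^sub>R v))\<^sup>2 > (\<theta> *\<^sub>R v) \<bullet> (B *v (\<theta> *\<^sub>R v))"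
        by (simp add: lorentz_def)
      moreover have "1 + \<beta> \<bullet> (\<theta> *\<^sub>R v) = 0" using 0 by (simp add: algebra_simps)
      ultimately show False using psd[of "\<theta> *\<^sub>R v"] by simp
    qed
    from affine_pos[OF zero_less_one this] have "0 < 1 + \<beta> \<bullet> v" by blast
    then show ?thesis using inside[OF v] by (simp add: nappe_def)
  qed
  moreover have "z \<in> cone_at q D" if z: "\<epsilon> \<le> lorentz \<beta> B z" "z - \<epsilon> *\<^sub>R (1, 0) \<in> nappe \<beta> B"
    "(1, 0) - \<epsilon> *\<^sub>R z \<in> nappe \<beta> B" for z
  proof -
    \<comment> \<open>Through \<open>nappe_pos\<close> the two nappe conditions bound
      \<open>X z\<close> and \<open>T z\<close> from below and above by multiples of their values at
      \<open>(1, 0)\<close>.\<close>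
    have z1: "\<epsilon> * \<delta> < X z" "\<epsilon> * (1 + K * \<delta>) < T z"
      using nappe_pos[OF z(2)] by (simp_all add: X_diff T_diff X_scale T_scale T1 flip: \<delta>_def del: scaleR_Pair)
    have z2: "\<epsilon> * X z < \<delta>" "\<epsilon> * T z < 1 + K * \<delta>"
      using nappe_pos[OF z(3)] by (simp_all add: X_diff T_diff X_scale T_scale T1 flip: \<delta>_def del: scaleR_Pair)
    have "\<epsilon> * \<delta> > 0" using \<epsilon> \<delta> by simp
    then have Xz: "X z > 0" using z1(1) by linarith
    have "\<epsilon> * \<mu> \<le> X z * T z - (1 - \<epsilon>^3 / 64) * Q (Y z)"
      using z(1) \<mu>0 by (simp add: F \<epsilon>'_def pos_le_divide_eq)
    note arith = sandwich_arith[OF \<epsilon> \<delta> K K\<delta> Xz z2(1) z1(2) z2(2) \<mu> Q_nonneg this]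
    define t where "t = T z - K * X z"
    have Mz: "M z = (t, Y z)" by (simp add: t_def T_def Y_def)
    have t: "\<epsilon> / 2 \<le> t" "t > 0" using arith(1) \<epsilon> by (simp_all add: t_def)
    define h where "h = (1/t) *\<^sub>R Y z"
    have "norm h < r2 / 2"
    proof -
      have "c * (norm (Y z))\<^sup>2 \<le> 4 * \<delta> / \<epsilon>\<^sup>2" using Q_lower[of "Y z"] arith(2) by linarith
      also have "\<dots> < 4 * (c * \<epsilon>^4 / 16 * (r2 / 2)\<^sup>2) / \<epsilon>\<^sup>2"
        using \<delta>_up \<eta>(5) \<epsilon> by (intro divide_strict_right_mono) auto
      also have "\<dots> = c * ((\<epsilon> / 2) * (r2 / 2))\<^sup>2"
        using \<epsilon> by (simp add: power2_eq_square power4_eq_xxxx)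
      finally have "(norm (Y z))\<^sup>2 < ((\<epsilon> / 2) * (r2 / 2))\<^sup>2" using c by simp
      then have "norm (Y z) < (\<epsilon> / 2) * (r2 / 2)"
        using \<epsilon> r2 by (intro power2_less_imp_less[of "norm (Y z)"]) auto
      also have "\<dots> \<le> t * (r2 / 2)" using t r2 by (intro mult_right_mono) auto
      finally show ?thesis using t by (simp add: h_def field_simps)
    qed
    then have "a + h \<in> ball p r2" using a \<eta> by (intro add_in_ball) auto
    moreover have "a \<in> ball p r2" using a \<eta> r2 by (simp add: dist_commute)
    \<comment> \<open>Here the inner quadric enters: positivity of the inner form at
      \<open>M z\<close> makes this Taylor upper bound negative.\<close>
    ultimately have "\<sigma> (a + h) \<le> G a \<bullet> h + (1 + \<epsilon>') * Q h"
      using tay[of a h] \<sigma>a by (simp add: abs_le_iff algebra_simps)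
    also have "\<dots> = (- (X z * t) + (1 + \<epsilon>') * Q (Y z)) / t\<^sup>2"
      using t by (simp add: h_def Q_scale X_def power2_eq_square field_simps)
    also have "\<dots> < 0"
      using arith(3) t by (simp add: divide_less_0_iff \<epsilon>'_def t_def)
    finally have "a + h \<in> D" using D_iff[of "a + h"] \<open>a + h \<in> ball p r2\<close> r2 by auto
    then have "M z \<in> cone_at a D" using t by (simp add: Mz cone_at_iff h_def)
    then show ?thesis by (simp add: M(3))
  qed
  ultimately show thesis using B(2) psd by (intro that) blast+
qed

end

section \<open>The limit cone\<close>

text \<open>The cone over \<open>D\<close> lies between the open and the closed cone of one form,
  and openness of \<open>D\<close> removes the boundary. A null vector of \<open>B\<close> would
  give a line in \<open>D\<close>, so \<open>B\<close> is the squared norm of an invertible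
  \<open>A\<close>, and \<open>A *v v\<close> divided by \<open>1 + \<beta> \<bullet> v\<close> maps
  \<open>D\<close> onto the ball.\<close>

lemma projectively_equivalent_to_ball_lorentz:
  fixes D :: "(real^'n) set"
  assumes "open D"
    and sym: "\<And>v w. v \<bullet> (B *v w) = w \<bullet> (B *v v)" and psd: "\<And>v. 0 \<le> v \<bullet> (B *v v)"
    and D_sub: "\<And>v. q + v \<in> D \<Longrightarrow> 0 \<le> 1 + \<beta> \<bullet> v \<and> 0 \<le> lorentz \<beta> B (1, v)"
    and sub_D: "nappe \<beta> B \<subseteq> cone_at q D"
    and no_line: "\<And>v. (\<And>s. q + s *\<^sub>R v \<in> D) \<Longrightarrow> v = 0"
  shows "projectively_equivalent_to_ball D"
proof -
  have pos: "v \<bullet> (B *v v) > 0" if "v \<noteq> 0" for v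
  proof (rule ccontr)
    assume "\<not> v \<bullet> (B *v v) > 0"
    then have 0: "v \<bullet> (B *v v) = 0" using psd[of v] by simp
    \<comment> \<open>The first coordinate is chosen so that the linear part equals 1; as
      \<open>B\<close> vanishes on \<open>v\<close>, the form is 1 as well, for every
      \<open>s\<close>.\<close>
    have in_cone: "(1 - s * (\<beta> \<bullet> v), s *\<^sub>R v) \<in> cone_at q D" for s
      using 0 by (intro subsetD[OF sub_D]) (simp add: nappe_def lorentz_def matrix_vector_mult_scaleR)
    have "\<beta> \<bullet> v = 0"
    proof (rule ccontr)
      assume "\<beta> \<bullet> v \<noteq> 0"
      then show False using in_cone[of "1 / (\<beta> \<bullet> v)"] by (simp add: cone_at_iff)
    qed
    then have "q + s *\<^sub>R v \<in> D" for s using in_cone[of s] by (simp add: cone_at_iff)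
    then show False using no_line that by blast
  qed
  obtain A :: "real^'n^'n" where A: "\<And>v. (norm (A *v v))\<^sup>2 = v \<bullet> (B *v v)"
    using posdef_form_eq_norm_square[OF sym pos] by blast
  have "inj ((*v) A)"
    unfolding linear_injective_0[OF matrix_vector_mul_linear]
    by (metis A less_irrefl norm_zero pos zero_power2)
  then have surj: "surj ((*v) A)" and inj: "A *v v = A *v w \<Longrightarrow> v = w" for v w
    by (simp_all add: linear_injective_imp_surjective inj_eq)
  have D_iff: "q + v \<in> D \<longleftrightarrow> norm (A *v v) < 1 + \<beta> \<bullet> v" for v
  proof
    assume v: "q + v \<in> D"
    \<comment> \<open>Openness allows stretching \<open>v\<close> by a factor above 1 inside
      \<open>D\<close>; the weak inequality at the stretched point becomes strict at
      \<open>v\<close>.\<close>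
    have "((\<lambda>s. q + (1 + s) *\<^sub>R v) \<longlongrightarrow> q + (1 + 0) *\<^sub>R v) (at_right 0)"
      by (intro tendsto_intros)
    then have "eventually (\<lambda>s. q + (1 + s) *\<^sub>R v \<in> D) (at_right 0)"
      using \<open>open D\<close> v by (intro topological_tendstoD) auto
    moreover have "eventually (\<lambda>s::real. s > 0) (at_right 0)" by (simp add: eventually_at_right_less)
    ultimately have "eventually (\<lambda>s. q + (1 + s) *\<^sub>R v \<in> D \<and> s > 0) (at_right 0)" by (rule eventually_conj)
    then obtain s where s: "q + (1 + s) *\<^sub>R v \<in> D" "s > 0"
      using eventually_happens trivial_limit_at_right_real by blast
    define \<tau> where "\<tau> = 1 + s"
    have \<tau>: "\<tau> > 1" using s by (simp add: \<tau>_def)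
    have "(\<tau> * norm (A *v v))\<^sup>2 = (\<tau> *\<^sub>R v) \<bullet> (B *v (\<tau> *\<^sub>R v))"
      by (simp add: power_mult_distrib A matrix_vector_mult_scaleR) (simp add: power2_eq_square)
    also have "\<dots> \<le> (1 + \<tau> * (\<beta> \<bullet> v))\<^sup>2"
      using D_sub[OF s(1)] by (simp add: \<tau>_def lorentz_def)
    finally have "(\<tau> * norm (A *v v))\<^sup>2 \<le> (1 + \<tau> * (\<beta> \<bullet> v))\<^sup>2" .
    moreover have "0 \<le> 1 + \<tau> * (\<beta> \<bullet> v)" using D_sub[OF s(1)] by (simp add: \<tau>_def)
    ultimately have "\<tau> * norm (A *v v) \<le> 1 + \<tau> * (\<beta> \<bullet> v)" by (rule power2_le_imp_le)
    also have "\<dots> < \<tau> + \<tau> * (\<beta> \<bullet> v)" using \<tau> by simp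
    finally have "\<tau> * norm (A *v v) < \<tau> * (1 + \<beta> \<bullet> v)" by (simp add: distrib_left)
    then show "norm (A *v v) < 1 + \<beta> \<bullet> v" using \<tau> by simp
  next
    assume v: "norm (A *v v) < 1 + \<beta> \<bullet> v"
    then have "(norm (A *v v))\<^sup>2 < (1 + \<beta> \<bullet> v)\<^sup>2" by (intro power_strict_mono) auto
    moreover have "0 < 1 + \<beta> \<bullet> v" using v norm_ge_zero[of "A *v v"] by linarith
    ultimately have "(1, v) \<in> nappe \<beta> B"
      by (simp add: nappe_def lorentz_def A)
    then show "q + v \<in> D" using sub_D by (auto simp: cone_at_iff dest!: subsetD)
  qed
  define f where "f x = (1 / (1 + \<beta> \<bullet> (x - q))) *\<^sub>R (A *v (x - q))" for x
  have den: "norm (A *v (x - q)) < 1 + \<beta> \<bullet> (x - q)" "1 + \<beta> \<bullet> (x - q) > 0" if "x \<in> D" for x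
  proof -
    show *: "norm (A *v (x - q)) < 1 + \<beta> \<bullet> (x - q)" using D_iff[of "x - q"] that by simp
    show "1 + \<beta> \<bullet> (x - q) > 0" using * norm_ge_zero[of "A *v (x - q)"] by linarith
  qed
  have "projective_map_on D f"
    unfolding projective_map_on_def
  proof (intro exI ballI)
    fix x assume "x \<in> D"
    then show "(1 - \<beta> \<bullet> q) + \<beta> \<bullet> x \<noteq> 0 \<and> f x = proj_fun (1 - \<beta> \<bullet> q) \<beta> (- (A *v q)) A x"
      using den[of x]
      by (simp add: f_def proj_fun_def inner_diff_right matrix_vector_mult_diff_distrib algebra_simps)
  qed
  moreover have "bij_betw f D (ball 0 1)"
  proof (rule bij_betwI')
    fix x y assume x: "x \<in> D" and y: "y \<in> D"
    show "f x = f y \<longleftrightarrow> x = y"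
    proof
      assume eq: "f x = f y"
      define s t where "s = 1 / (1 + \<beta> \<bullet> (x - q))" and "t = 1 / (1 + \<beta> \<bullet> (y - q))"
      have st: "s > 0" "t > 0" using den x y by (simp_all add: s_def t_def)
      have "A *v (s *\<^sub>R (x - q)) = A *v (t *\<^sub>R (y - q))"
        using eq by (simp add: f_def s_def t_def matrix_vector_mult_scaleR)
      then have w: "s *\<^sub>R (x - q) = t *\<^sub>R (y - q)" by (rule inj)
      have "s * (1 + \<beta> \<bullet> (x - q)) = 1" "t * (1 + \<beta> \<bullet> (y - q)) = 1"
        using den(2)[OF x] den(2)[OF y] by (simp_all add: s_def t_def)
      then have "1 = s + \<beta> \<bullet> (s *\<^sub>R (x - q))" "1 = t + \<beta> \<bullet> (t *\<^sub>R (y - q))"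
        by (simp_all add: distrib_left)
      then have "s = t" using w by simp
      then have "x - q = y - q" using w st by simp
      then show "x = y" by simp
    qed simp
  next
    fix x assume "x \<in> D"
    then show "f x \<in> ball 0 1" using den[of x] by (simp add: f_def)
  next
    fix y :: "real^'n" assume y: "y \<in> ball 0 1"
    obtain w where w: "A *v w = y" using surj by (metis surjD)
    \<comment> \<open>With this \<open>t\<close> the linear part at \<open>(t, w)\<close> is 1 and
      the form is 1 minus the squared norm of \<open>y\<close>.\<close>
    define t where "t = 1 - \<beta> \<bullet> w"
    have "(norm y)\<^sup>2 < 1" using y by (simp add: power_less_one_iff abs_square_less_1)
    then have "(t, w) \<in> nappe \<beta> B"
      by (simp add: nappe_def lorentz_def t_def w flip: A)
    then have "(t, w) \<in> cone_at q D" using sub_D by blast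
    then have t: "t > 0" "q + (1/t) *\<^sub>R w \<in> D" by (simp_all add: cone_at_iff)
    have "1 + \<beta> \<bullet> ((1/t) *\<^sub>R w) = 1 / t" using t by (simp add: t_def field_simps)
    then have "f (q + (1/t) *\<^sub>R w) = y" using t by (simp add: f_def matrix_vector_mult_scaleR w)
    then show "\<exists>x\<in>D. y = f x" using t by blast
  qed
  ultimately show ?thesis unfolding projectively_equivalent_to_ball_def by blast
qed

text \<open>Compactness for normalised forms whose nappes contain a fixed ball at height 1. Testing
  against the direction of \<open>- \<beta>\<close> bounds \<beta>; then
  \<open>v \<bullet> (B *v v) < (1 + \<beta> \<bullet> v)\<^sup>2\<close> bounds the form
  \<open>B\<close> on the ball.\<close>

lemma nappe_bounds:
  fixes B :: "real^'n^'n"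
  assumes sym: "\<And>v w. v \<bullet> (B *v w) = w \<bullet> (B *v v)" and psd: "\<And>v. 0 \<le> v \<bullet> (B *v v)"
    and r: "r > 0" and nap: "\<And>v. norm v \<le> r \<Longrightarrow> (1, v) \<in> nappe \<beta> B"
  shows "norm \<beta> \<le> 1 / r" "norm B \<le> CARD('n) * (CARD('n) * (4 / r\<^sup>2))"
proof -
  show \<beta>: "norm \<beta> \<le> 1 / r"
  proof (cases "\<beta> = 0")
    case False
    have "(1, (- r / norm \<beta>) *\<^sub>R \<beta>) \<in> nappe \<beta> B" using False r by (intro nap) simp
    then have "0 < 1 + \<beta> \<bullet> ((- r / norm \<beta>) *\<^sub>R \<beta>)" by (simp add: nappe_def)
    also have "\<beta> \<bullet> ((- r / norm \<beta>) *\<^sub>R \<beta>) = - r * norm \<beta>"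
      using False by (simp add: dot_square_norm power2_eq_square)
    finally show ?thesis using r by (simp add: field_simps)
  qed (use r in simp)
  have small: "v \<bullet> (B *v v) \<le> 4" if "norm v \<le> r" for v
  proof -
    have "\<bar>\<beta> \<bullet> v\<bar> \<le> norm \<beta> * norm v" by (rule Cauchy_Schwarz_ineq2)
    also have "\<dots> \<le> (1 / r) * r" using \<beta> that r by (intro mult_mono) auto
    finally have "\<bar>\<beta> \<bullet> v\<bar> \<le> 1" using r by simp
    then have "\<bar>1 + \<beta> \<bullet> v\<bar> \<le> 2" by linarith
    then have "(1 + \<beta> \<bullet> v)\<^sup>2 \<le> 2\<^sup>2" using abs_le_square_iff[of "1 + \<beta> \<bullet> v" 2] by simp
    moreover have "v \<bullet> (B *v v) < (1 + \<beta> \<bullet> v)\<^sup>2"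
      using nap[OF that] by (simp add: nappe_def lorentz_def)
    ultimately show ?thesis by simp
  qed
  have two: "v \<bullet> (B *v v) \<le> 16 / r\<^sup>2" if "norm v \<le> 2" for v
  proof -
    have "norm ((r / 2) *\<^sub>R v) \<le> r" using that r mult_left_mono[of "norm v" 2 r] by simp
    from small[OF this] have "(r / 2)\<^sup>2 * (v \<bullet> (B *v v)) \<le> 4"
      by (simp add: matrix_vector_mult_scaleR power2_eq_square)
    then show ?thesis using r by (simp add: field_simps power2_eq_square)
  qed
  have entry: "\<bar>B $ i $ j\<bar> \<le> 4 / r\<^sup>2" for i j
  proof -
    let ?a = "axis i 1 :: real^'n" and ?b = "axis j 1 :: real^'n"
    have n: "norm (?a + ?b) \<le> 2" "norm (?a - ?b) \<le> 2"
      using norm_triangle_ineq[of ?a ?b] norm_triangle_ineq4[of ?a ?b] by simp_all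
    have "B $ i $ j = ?a \<bullet> (B *v ?b)"
      by (simp add: matrix_vector_mult_basis column_def inner_axis')
    \<comment> \<open>Polarisation: four times the entry is a difference of two numbers between 0
      and \<open>16 / r\<^sup>2\<close>.\<close>
    moreover have "4 * (?a \<bullet> (B *v ?b)) = (?a + ?b) \<bullet> (B *v (?a + ?b)) - (?a - ?b) \<bullet> (B *v (?a - ?b))"
      using sym[of ?a ?b]
      by (simp add: matrix_vector_mult_diff_distrib matrix_vector_right_distrib inner_add_left
          inner_add_right inner_diff_left inner_diff_right)
    ultimately show ?thesis
      using two[OF n(1)] two[OF n(2)] psd[of "?a + ?b"] psd[of "?a - ?b"] by linarith
  qed
  have "norm B \<le> (\<Sum>i\<in>UNIV. norm (B $ i))"
    unfolding norm_vec_def by (rule L2_set_le_sum) simp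
  also have "\<dots> \<le> (\<Sum>i\<in>(UNIV::'n set). CARD('n) * (4 / r\<^sup>2))"
  proof (rule sum_mono)
    fix i
    have "norm (B $ i) \<le> (\<Sum>j\<in>UNIV. \<bar>B $ i $ j\<bar>)" by (rule norm_le_l1_cart)
    also have "\<dots> \<le> (\<Sum>j\<in>(UNIV::'n set). 4 / r\<^sup>2)" by (intro sum_mono entry)
    finally show "norm (B $ i) \<le> CARD('n) * (4 / r\<^sup>2)" by simp
  qed
  finally show "norm B \<le> CARD('n) * (CARD('n) * (4 / r\<^sup>2))" by simp
qed

section \<open>Convergence of the forms and the limit cone\<close>

lemma tendsto_matrix_vector_mult:
  fixes B :: "'b \<Rightarrow> real^'n^'m"
  assumes "(B \<longlongrightarrow> B') F" "(v \<longlongrightarrow> v') F"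
  shows "((\<lambda>k. B k *v v k) \<longlongrightarrow> B' *v v') F"
  unfolding matrix_vector_mult_def by (intro tendsto_intros tendsto_vec_lambda assms)

lemma tendsto_lorentz:
  assumes "(\<beta> \<longlongrightarrow> \<beta>') F" "(B \<longlongrightarrow> B') F" "(z \<longlongrightarrow> z') F"
  shows "((\<lambda>k. lorentz (\<beta> k) (B k) (z k)) \<longlongrightarrow> lorentz \<beta>' B' z') F"
  unfolding lorentz_def by (intro tendsto_intros tendsto_matrix_vector_mult assms)

lemma eventually_nappe:
  assumes "(\<beta> \<longlongrightarrow> \<beta>') F" "(B \<longlongrightarrow> B') F" "(z \<longlongrightarrow> z') F" "z' \<in> nappe \<beta>' B'"
  shows "eventually (\<lambda>k. z k \<in> nappe (\<beta> k) (B k)) F"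
proof -
  have "((\<lambda>k. fst (z k) + \<beta> k \<bullet> snd (z k)) \<longlongrightarrow> fst z' + \<beta>' \<bullet> snd z') F"
    by (intro tendsto_intros assms)
  then have "eventually (\<lambda>k. 0 < fst (z k) + \<beta> k \<bullet> snd (z k)) F"
    by (rule order_tendstoD) (use assms(4) in \<open>simp add: nappe_def\<close>)
  moreover have "eventually (\<lambda>k. 0 < lorentz (\<beta> k) (B k) (z k)) F"
    by (rule order_tendstoD[OF tendsto_lorentz[OF assms(1-3)]]) (use assms(4) in \<open>simp add: nappe_def\<close>)
  ultimately show ?thesis by eventually_elim (simp add: nappe_def)
qed

theorem theorem4:
  fixes D :: "(real^'n) set" and p q :: "real^'n" and \<phi> :: "nat \<Rightarrow> real^'n \<Rightarrow> real^'n"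
  assumes "domain D"
    and "p \<in> frontier D" and "q \<in> D"
    and "\<And>j. projective_automorphism D (\<phi> j)"
    and "(\<lambda>j. \<phi> j q) \<longlonglongrightarrow> p"
    and "strictly_convex_boundary_point D p"
  shows "projectively_equivalent_to_ball D"
proof -
  have "open D" using assms(1) by (simp add: domain_def)
  obtain \<sigma> G P c C r0 where "osculated_boundary D p \<sigma> G P c C r0"
    using strictly_convex_imp_osculated[OF assms(6) \<open>open D\<close>] by blast
  then interpret osculated_boundary D p \<sigma> G P c C r0 .
  \<comment> \<open>A null sequence of margins; the summand 2 keeps even \<open>e 0\<close> below
    1.\<close>
  define e where "e k = 1 / (real k + 2)" for k
  have e: "0 < e k" "e k < 1" for k by (simp_all add: e_def)
  have e_lim: "e \<longlonglongrightarrow> 0"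
  proof -
    have "(\<lambda>k. 1 / real (k + 2)) \<longlonglongrightarrow> 0"
      by (rule LIMSEQ_ignore_initial_segment[OF lim_1_over_n])
    then show ?thesis by (simp add: e_def[abs_def] add.commute)
  qed
  define good where "good k \<beta> B \<longleftrightarrow> (\<forall>v w. v \<bullet> (B *v w) = w \<bullet> (B *v v)) \<and> (\<forall>v. 0 \<le> v \<bullet> (B *v v)) \<and>
      (\<forall>v. q + v \<in> D \<longrightarrow> (1, v) \<in> nappe \<beta> B) \<and>
      (\<forall>z. e k \<le> lorentz \<beta> B z \<longrightarrow> z - e k *\<^sub>R (1, 0) \<in> nappe \<beta> B \<longrightarrow> (1, 0) - e k *\<^sub>R z \<in> nappe \<beta> B
        \<longrightarrow> z \<in> cone_at q D)" for k \<beta> B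
  have "\<exists>\<beta> B. good k \<beta> B" for k
  proof (rule sandwich[OF assms(1,4,3,5) e[of k]])
    fix \<beta> B
    assume 1: "\<And>v w. v \<bullet> (B *v w) = w \<bullet> (B *v v)" and 2: "\<And>v. 0 \<le> v \<bullet> (B *v v)"
      and 3: "\<And>v. q + v \<in> D \<Longrightarrow> (1, v) \<in> nappe \<beta> B"
      and 4: "\<And>z. \<lbrakk>e k \<le> lorentz \<beta> B z; z - e k *\<^sub>R (1, 0) \<in> nappe \<beta> B;
        (1, 0) - e k *\<^sub>R z \<in> nappe \<beta> B\<rbrakk> \<Longrightarrow> z \<in> cone_at q D"
    have "good k \<beta> B" unfolding good_def by (intro conjI allI impI 1 2 3 4)
    then show "\<exists>\<beta> B. good k \<beta> B" by blast
  qed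
  then obtain \<beta> B where good: "\<And>k. good k (\<beta> k) (B k)" by metis
  have sym: "\<And>k v w. v \<bullet> (B k *v w) = w \<bullet> (B k *v v)" and psd: "\<And>k v. 0 \<le> v \<bullet> (B k *v v)"
    and outer: "\<And>k v. q + v \<in> D \<Longrightarrow> (1, v) \<in> nappe (\<beta> k) (B k)"
    using good unfolding good_def by simp_all
  have inner: "z \<in> cone_at q D" if "e k \<le> lorentz (\<beta> k) (B k) z"
      "z - e k *\<^sub>R (1, 0) \<in> nappe (\<beta> k) (B k)" "(1, 0) - e k *\<^sub>R z \<in> nappe (\<beta> k) (B k)" for k z
    by (rule good[of k, unfolded good_def, THEN conjunct2, THEN conjunct2, THEN conjunct2, rule_format, OF that])
  \<comment> \<open>One ball around \<open>q\<close> serves all \<open>k\<close>, so the bounds on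
    the forms are uniform.\<close>
  obtain r where r: "r > 0" "cball q r \<subseteq> D"
    using \<open>open D\<close> assms(3) by (meson open_contains_cball)
  have near: "(1, v) \<in> nappe (\<beta> k) (B k)" if "norm v \<le> r" for v k
    using r that by (intro outer subsetD[OF r(2)]) (simp add: dist_norm)
  have "norm (\<beta> k) \<le> 1 / r" "norm (B k) \<le> CARD('n) * (CARD('n) * (4 / r\<^sup>2))" for k
    using nappe_bounds[OF sym psd r(1) near] by blast+
  then have "range (\<lambda>k. (\<beta> k, B k)) \<subseteq> cball 0 (1 / r) \<times> cball 0 (CARD('n) * (CARD('n) * (4 / r\<^sup>2)))"
    by auto
  then have "bounded (range (\<lambda>k. (\<beta> k, B k)))"
    by (rule bounded_subset[rotated]) (intro bounded_Times bounded_cball)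
  then obtain l g where g: "strict_mono g" "((\<lambda>k. (\<beta> k, B k)) \<circ> g) \<longlonglongrightarrow> l"
    using bounded_imp_convergent_subsequence by blast
  define \<beta>' B' where "\<beta>' = fst l" and "B' = snd l"
  have \<beta>: "(\<lambda>k. \<beta> (g k)) \<longlonglongrightarrow> \<beta>'" and B: "(\<lambda>k. B (g k)) \<longlonglongrightarrow> B'"
    using tendsto_fst[OF g(2)] tendsto_snd[OF g(2)] by (simp_all add: o_def \<beta>'_def B'_def)
  have eg: "(\<lambda>k. e (g k)) \<longlonglongrightarrow> 0"
    using LIMSEQ_subseq_LIMSEQ[OF e_lim g(1)] by (simp add: o_def)
  show ?thesis
  proof (rule projectively_equivalent_to_ball_lorentz[OF \<open>open D\<close>, of B' q \<beta>'])
    have Bv: "(\<lambda>k. v \<bullet> (B (g k) *v w)) \<longlonglongrightarrow> v \<bullet> (B' *v w)" for v w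
      by (intro tendsto_intros tendsto_matrix_vector_mult B)
    show "v \<bullet> (B' *v w) = w \<bullet> (B' *v v)" for v w
      using LIMSEQ_unique[OF Bv[of v w]] Bv[of w v] by (simp add: sym[of v _ w])
    show "0 \<le> v \<bullet> (B' *v v)" for v
      using LIMSEQ_le_const[OF Bv[of v v]] psd by blast
    show "0 \<le> 1 + \<beta>' \<bullet> v \<and> 0 \<le> lorentz \<beta>' B' (1, v)" if "q + v \<in> D" for v
    proof
      have "(\<lambda>k. 1 + \<beta> (g k) \<bullet> v) \<longlonglongrightarrow> 1 + \<beta>' \<bullet> v" by (intro tendsto_intros \<beta>)
      then show "0 \<le> 1 + \<beta>' \<bullet> v"
        by (rule LIMSEQ_le_const) (use outer[OF that] in \<open>auto simp: nappe_def less_imp_le\<close>)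
      have "(\<lambda>k. lorentz (\<beta> (g k)) (B (g k)) (1, v)) \<longlonglongrightarrow> lorentz \<beta>' B' (1, v)"
        by (intro tendsto_lorentz \<beta> B tendsto_const)
      then show "0 \<le> lorentz \<beta>' B' (1, v)"
        by (rule LIMSEQ_le_const) (use outer[OF that] in \<open>auto simp: nappe_def less_imp_le\<close>)
    qed
    show "nappe \<beta>' B' \<subseteq> cone_at q D"
    proof
      fix z assume z: "z \<in> nappe \<beta>' B'"
      \<comment> \<open>The hypotheses of \<open>inner\<close> along the subsequence tend to strict
        conditions satisfied by \<open>z\<close> and \<open>(1, 0)\<close>, so they hold eventually;
        the conclusion \<open>z \<in> cone_at q D\<close> does not depend on
        \<open>k\<close>.\<close>
      have "(\<lambda>k. z - e (g k) *\<^sub>R (1, 0)) \<longlonglongrightarrow> z - 0 *\<^sub>R (1, 0)" "(\<lambda>k. (1, 0) - e (g k) *\<^sub>R z) \<longlonglongrightarrow> (1, 0) - 0 *\<^sub>R z"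
        by (intro tendsto_intros eg)+
      then have "(\<lambda>k. z - e (g k) *\<^sub>R (1, 0)) \<longlonglongrightarrow> z" "(\<lambda>k. (1, 0) - e (g k) *\<^sub>R z) \<longlonglongrightarrow> (1, 0)"
        by (simp_all del: scaleR_Pair)
      moreover have "(1, 0) \<in> nappe \<beta>' B'" by (simp add: nappe_def lorentz_def)
      ultimately have "eventually (\<lambda>k. z - e (g k) *\<^sub>R (1, 0) \<in> nappe (\<beta> (g k)) (B (g k))) sequentially"
        "eventually (\<lambda>k. (1, 0) - e (g k) *\<^sub>R z \<in> nappe (\<beta> (g k)) (B (g k))) sequentially"
        using z by (auto intro: eventually_nappe[OF \<beta> B])
      moreover have "(\<lambda>k. lorentz (\<beta> (g k)) (B (g k)) z - e (g k)) \<longlonglongrightarrow> lorentz \<beta>' B' z - 0"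
        by (intro tendsto_diff tendsto_lorentz \<beta> B tendsto_const eg)
      then have "eventually (\<lambda>k. 0 < lorentz (\<beta> (g k)) (B (g k)) z - e (g k)) sequentially"
        by (rule order_tendstoD) (use z in \<open>simp add: nappe_def\<close>)
      ultimately have "eventually (\<lambda>k. z \<in> cone_at q D) sequentially"
        by eventually_elim (rule inner, simp_all del: scaleR_Pair)
      then show "z \<in> cone_at q D" by simp
    qed
    show "v = 0" if "\<And>s. q + s *\<^sub>R v \<in> D" for v
      using no_line[OF convex_D[OF assms(1,4,3,5)]] that by blast
  qed
qed

end
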